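(* Let $\mathbf{a}=\{a_1,\dots,a_n\}$ and $\mathbf{b}=\{b_1,\dots,b_n\}$ be disjoint subsets of the unit disk $\mathbb{D}$ with $n$ elements each, let $B_{\mathbf{a}},B_{\mathbf{b}}$ be the finite Blaschke products with simple zeros $\mathbf{a}$ and $\mathbf{b}$, and suppose the $b_j$ are arranged so that $|B_{\mathbf{a}}(b_1)|=\max_{1\le j\le n}|B_{\mathbf{a}}(b_j)|$. Let $\mathcal{Z}^0_{\mathbf{a}},\mathcal{Z}^0_{\mathbf{b}}$ and $X_{\mathbf{ab}}$ be as defined in the context, and let $s_{n-1}(P_{\mathcal{Z}^0_{\mathbf{a}}}P_{\mathcal{Z}^0_{\mathbf{b}}})$ be the smallest of the $n$ singular values $s_0\ge\dots\ge s_{n-1}$ of $P_{\mathcal{Z}^0_{\mathbf{a}}}P_{\mathcal{Z}^0_{\mathbf{b}}}$. Then: 1. $$s_{n-1}(P_{\mathcal{Z}^0_{\mathbf{a}}}P_{\mathcal{Z}^0_{\mathbf{b}}})\le\sqrt{1-|B_{\mathbf{a}}(b_1)|^2}.$$ 2. $$\|X_{\mathbf{ab}}\|\ge\arcsin\left(\max_{1\le j,k\le n}\{|B_{\mathbf{a}}(b_j)|,|B_{\mathbf{b}}(a_k)|\}\right).$$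
   Context: $H^2$ is the Hardy space of the disk, with Szegő kernels $k_w(z)=\frac1{1-\bar wz}$. $B_{\mathbf{a}}=\prod_{j=1}^n b_{a_j}$, where $b_0(z)=z$ and $b_{a}(z)=\frac{\bar a}{|a|}\frac{a-z}{1-\bar az}$ for $a\ne0$; similarly $B_{\mathbf{b}}$. $\mathcal{H}_0$ is the $2n$-dimensional span of $\{k_{a_i},k_{b_j}:1\le i,j\le n\}$ in $H^2$; $\mathcal{Z}^0_{\mathbf{a}}$ (resp. $\mathcal{Z}^0_{\mathbf{b}}$) is the $n$-dimensional subspace of functions in $\mathcal{H}_0$ vanishing on $\mathbf{a}$ (resp. $\mathbf{b}$), and $P_{\mathcal{S}}$ is the orthogonal projection onto $\mathcal{S}$. The singular values of $P_{\mathcal{Z}^0_{\mathbf{a}}}P_{\mathcal{Z}^0_{\mathbf{b}}}$ are those of it as an operator from $\mathcal{Z}^0_{\mathbf{b}}$ to $\mathcal{Z}^0_{\mathbf{a}}$ (equivalently its $n$ largest singular values on $\mathcal{H}_0$). The two subspaces are in generic position in $\mathcal{H}_0$, and $X_{\mathbf{ab}}$ is the exponent of the unique minimal geodesic joining them: the unique self-adjoint operator on $\mathcal{H}_0$ with $\|X_{\mathbf{ab}}\|\le\pi/2$, $X_{\mathbf{ab}}\mathcal{Z}^0_{\mathbf{a}}\subset(\mathcal{Z}^0_{\mathbf{a}})^\perp$, $X_{\mathbf{ab}}(\mathcal{Z}^0_{\mathbf{a}})^\perp\subset\mathcal{Z}^0_{\mathbf{a}}$ (complements in $\mathcal{H}_0$)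 and $e^{iX_{\mathbf{ab}}}\mathcal{Z}^0_{\mathbf{a}}=\mathcal{Z}^0_{\mathbf{b}}$. *)

theory Defs
  imports "HOL-Complex_Analysis.Complex_Analysis"
begin

definition taylor_coeff :: "(complex \<Rightarrow> complex) \<Rightarrow> nat \<Rightarrow> complex" where
  "taylor_coeff f n = (deriv ^^ n) f 0 / fact n"

text \<open>Elements of \<open>H\<^sup>2\<close> are functions on the open unit disk; as HOL functions are total, they are
  normalised to be \<open>0\<close> off the disk.\<close>

definition hardy_set :: "(complex \<Rightarrow> complex) set" where
  "hardy_set = {f. f holomorphic_on ball 0 1 \<and> (\<forall>z. z \<notin> ball 0 1 \<longrightarrow> f z = 0) \<and>
                   summable (\<lambda>n. (cmod (taylor_coeff f n))\<^sup>2)}"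

lemma taylor_coeff_add:
  assumes "f holomorphic_on ball 0 1" "g holomorphic_on ball 0 1"
  shows "taylor_coeff (\<lambda>z. f z + g z) n = taylor_coeff f n + taylor_coeff g n"
  using higher_deriv_add[OF assms, of 0 n] by (simp add: taylor_coeff_def add_divide_distrib)

lemma taylor_coeff_cmult:
  assumes "f holomorphic_on ball 0 1"
  shows "taylor_coeff (\<lambda>z. c * f z) n = c * taylor_coeff f n"
  using higher_deriv_cmult[OF assms, of 0 n c] by (simp add: taylor_coeff_def)

lemma hardy_set_zero: "(\<lambda>z. 0) \<in> hardy_set"
proof -
  have "taylor_coeff (\<lambda>z. 0) n = 0" for n
    by (simp add: taylor_coeff_def)
  then show ?thesis by (simp add: hardy_set_def)
qed

lemma hardy_set_add:
  assumes f: "f \<in> hardy_set" and g: "g \<in> hardy_set"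
  shows "(\<lambda>z. f z + g z) \<in> hardy_set"
proof -
  have hf: "f holomorphic_on ball 0 1" and hg: "g holomorphic_on ball 0 1"
    using f g by (auto simp: hardy_set_def)
  have le: "(cmod (x + y))\<^sup>2 \<le> 2 * (cmod x)\<^sup>2 + 2 * (cmod y)\<^sup>2" for x y
  proof -
    have "(cmod (x + y))\<^sup>2 \<le> (cmod x + cmod y)\<^sup>2"
      by (intro power_mono norm_triangle_ineq) auto
    also have "\<dots> \<le> 2 * (cmod x)\<^sup>2 + 2 * (cmod y)\<^sup>2"
      using zero_le_power2[of "cmod x - cmod y"] by (simp add: power2_sum power2_diff)
    finally show ?thesis .
  qed
  have "summable (\<lambda>n. 2 * (cmod (taylor_coeff f n))\<^sup>2 + 2 * (cmod (taylor_coeff g n))\<^sup>2)"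
    using f g by (intro summable_add summable_mult) (auto simp: hardy_set_def)
  then have "summable (\<lambda>n. (cmod (taylor_coeff f n + taylor_coeff g n))\<^sup>2)"
    by (rule summable_comparison_test[rotated]) (use le in auto)
  then show ?thesis
    using f g by (auto simp: hardy_set_def taylor_coeff_add[OF hf hg] intro!: holomorphic_intros)
qed

lemma hardy_set_cmult:
  assumes f: "f \<in> hardy_set"
  shows "(\<lambda>z. c * f z) \<in> hardy_set"
proof -
  have hf: "f holomorphic_on ball 0 1" using f by (simp add: hardy_set_def)
  have "summable (\<lambda>n. (cmod c)\<^sup>2 * (cmod (taylor_coeff f n))\<^sup>2)"
    using f by (intro summable_mult) (simp add: hardy_set_def)
  then show ?thesis
    using f by (auto simp: hardy_set_def taylor_coeff_cmult[OF hf] norm_mult power_mult_distrib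
        intro!: holomorphic_intros)
qed

lemma taylor_coeff_inverse_linear: "taylor_coeff (\<lambda>z. 1 / (1 - c * z)) n = c ^ n"
proof -
  have "(\<lambda>z. inverse (1 - c * z)) has_fps_expansion inverse (1 - fps_const c * fps_X)"
    by (intro fps_expansion_intros) auto
  also have "inverse (1 - fps_const c * fps_X) = Abs_fps (\<lambda>n. c ^ n)"
  proof (rule fps_inverse_unique)
    show "(1 - fps_const c * fps_X) * Abs_fps (\<lambda>n. c ^ n) = 1"
    proof (rule fps_ext)
      fix k show "((1 - fps_const c * fps_X) * Abs_fps (\<lambda>n. c ^ n)) $ k = 1 $ k"
        by (cases k) (simp_all add: algebra_simps)
    qed
  qed
  finally show ?thesis
    using fps_nth_fps_expansion[of "\<lambda>z. inverse (1 - c * z)" "Abs_fps (\<lambda>n. c ^ n)" n]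
    by (simp add: taylor_coeff_def inverse_eq_divide)
qed

lemma taylor_coeff_cong:
  assumes "\<And>z. z \<in> ball 0 1 \<Longrightarrow> f z = g z"
  shows "taylor_coeff f n = taylor_coeff g n"
proof -
  have "eventually (\<lambda>z. f z = g z) (nhds 0)"
    using assms eventually_nhds_in_open[of "ball 0 (1::real)" "0::complex"]
    by (auto elim: eventually_mono)
  then show ?thesis
    by (simp add: taylor_coeff_def higher_deriv_cong_ev)
qed

lemma taylor_coeff_szego:
  "taylor_coeff (\<lambda>z. if cmod z < 1 then 1 / (1 - cnj w * z) else 0) n = cnj w ^ n"
proof -
  have "taylor_coeff (\<lambda>z. if cmod z < 1 then 1 / (1 - cnj w * z) else 0) n =
        taylor_coeff (\<lambda>z. 1 / (1 - cnj w * z)) n"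
    by (rule taylor_coeff_cong) auto
  then show ?thesis by (simp add: taylor_coeff_inverse_linear)
qed

lemma hardy_set_szego:
  assumes w: "cmod w < 1"
  shows "(\<lambda>z. if cmod z < 1 then 1 / (1 - cnj w * z) else 0) \<in> hardy_set"
proof -
  have nz: "1 - cnj w * z \<noteq> 0" if "z \<in> ball 0 1" for z
  proof
    assume "1 - cnj w * z = 0"
    then have "cmod w * cmod z = 1"
      by (metis complex_mod_cnj eq_iff_diff_eq_0 norm_mult norm_one)
    moreover have "cmod w * cmod z < 1 * 1"
      using w that by (intro mult_strict_mono') auto
    ultimately show False by simp
  qed
  have "(\<lambda>z. 1 / (1 - cnj w * z)) holomorphic_on ball 0 1"
    using nz by (intro holomorphic_intros) auto
  then have "(\<lambda>z. if cmod z < 1 then 1 / (1 - cnj w * z) else 0) holomorphic_on ball 0 1"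
    by (rule holomorphic_transform) auto
  moreover have "summable (\<lambda>n. ((cmod w)\<^sup>2) ^ n)"
    using w by (intro summable_geometric) (simp add: abs_square_less_1)
  ultimately show ?thesis
    by (auto simp: hardy_set_def taylor_coeff_szego norm_power power_mult[symmetric] mult.commute)
qed

typedef hardy = hardy_set
  morphisms hardy_fun Abs_hardy
  using hardy_set_zero by blast

setup_lifting type_definition_hardy

text \<open>The kernel is only meaningful for \<open>w\<close> in the disk; the convention \<open>szego w = 0\<close> for other
  \<open>w\<close> makes it total.\<close>

lift_definition szego :: "complex \<Rightarrow> hardy" is
  "\<lambda>w z. if cmod w < 1 \<and> cmod z < 1 then 1 / (1 - cnj w * z) else 0"
proof -
  fix w :: complex
  show "(\<lambda>z. if cmod w < 1 \<and> cmod z < 1 then 1 / (1 - cnj w * z) else 0) \<in> hardy_set"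
    using hardy_set_szego[of w] hardy_set_zero by (cases "cmod w < 1") auto
qed

lift_definition hscale :: "complex \<Rightarrow> hardy \<Rightarrow> hardy" is "\<lambda>c f z. c * f z"
  by (rule hardy_set_cmult)

lift_definition hcoeff :: "hardy \<Rightarrow> nat \<Rightarrow> complex" is taylor_coeff .

definition hinner :: "hardy \<Rightarrow> hardy \<Rightarrow> complex" where
  "hinner f g = (\<Sum>n. hcoeff f n * cnj (hcoeff g n))"

instantiation hardy :: ab_group_add
begin

lift_definition zero_hardy :: hardy is "\<lambda>z. 0" by (rule hardy_set_zero)
lift_definition plus_hardy :: "hardy \<Rightarrow> hardy \<Rightarrow> hardy" is "\<lambda>f g z. f z + g z"
  by (rule hardy_set_add)
lift_definition uminus_hardy :: "hardy \<Rightarrow> hardy" is "\<lambda>f z. - f z"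
proof -
  fix f assume "f \<in> hardy_set"
  from hardy_set_cmult[OF this, of "-1"] show "(\<lambda>z. - f z) \<in> hardy_set" by simp
qed
definition minus_hardy :: "hardy \<Rightarrow> hardy \<Rightarrow> hardy" where "minus_hardy f g = f + - g"

instance
  by standard (simp add: minus_hardy_def | transfer, simp add: fun_eq_iff algebra_simps)+

end

global_interpretation hardy: vector_space hscale
  by standard (transfer, simp add: fun_eq_iff algebra_simps)+

lemma hcoeff_add: "hcoeff (f + g) n = hcoeff f n + hcoeff g n"
  by transfer (auto simp: hardy_set_def taylor_coeff_add)

lemma hcoeff_hscale: "hcoeff (hscale c f) n = c * hcoeff f n"
  by transfer (auto simp: hardy_set_def taylor_coeff_cmult)

lemma summable_hcoeff: "summable (\<lambda>n. (cmod (hcoeff f n))\<^sup>2)"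
  by transfer (simp add: hardy_set_def)

lemma hcoeff_szego: "cmod w < 1 \<Longrightarrow> hcoeff (szego w) n = cnj w ^ n"
  by transfer (simp add: taylor_coeff_szego)

lemma hcoeff_eq_0_imp:
  assumes "\<And>n. hcoeff f n = 0" shows "f = 0"
  using assms
proof transfer
  fix f assume f: "f \<in> hardy_set" and z: "\<And>n. taylor_coeff f n = 0"
  have "f w = (\<lambda>z. 0) w" if "w \<in> ball 0 1" for w
    by (rule holomorphic_fun_eq_on_ball[of f 0 1])
       (use f z that in \<open>auto simp: hardy_set_def taylor_coeff_def\<close>)
  with f show "f = (\<lambda>z. 0)" by (auto simp: hardy_set_def fun_eq_iff)
qed

lemma summable_hinner: "summable (\<lambda>n. hcoeff f n * cnj (hcoeff g n))"
proof (rule summable_comparison_test)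
  show "summable (\<lambda>n. (cmod (hcoeff f n))\<^sup>2 + (cmod (hcoeff g n))\<^sup>2)"
    by (intro summable_add summable_hcoeff)
  have "x * y \<le> x\<^sup>2 + y\<^sup>2" if "x \<ge> 0" "y \<ge> 0" for x y :: real
  proof -
    have "2 * (x * y) \<le> x\<^sup>2 + y\<^sup>2"
      using zero_le_power2[of "x - y"] by (simp add: power2_diff)
    moreover have "0 \<le> x * y" using that by simp
    ultimately show ?thesis by simp
  qed
  then show "\<exists>N. \<forall>n\<ge>N. norm (hcoeff f n * cnj (hcoeff g n))
               \<le> (cmod (hcoeff f n))\<^sup>2 + (cmod (hcoeff g n))\<^sup>2"
    by (auto simp: norm_mult)
qed

lemma hinner_add_left: "hinner (f + g) h = hinner f h + hinner g h"
  unfolding hinner_def by (simp add: hcoeff_add distrib_right suminf_add summable_hinner)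

lemma hinner_hscale_left: "hinner (hscale c f) h = c * hinner f h"
  unfolding hinner_def by (simp add: hcoeff_hscale mult.assoc suminf_mult summable_hinner)

lemma hinner_commute: "hinner f g = cnj (hinner g f)"
proof -
  have "(\<lambda>n. cnj (hcoeff g n * cnj (hcoeff f n))) sums cnj (hinner g f)"
    unfolding hinner_def by (subst sums_cnj) (rule summable_sums[OF summable_hinner])
  then show ?thesis
    unfolding hinner_def by (intro sums_unique[symmetric]) (simp add: mult.commute)
qed

lemma hinner_self: "hinner f f = of_real (\<Sum>n. (cmod (hcoeff f n))\<^sup>2)"
  unfolding hinner_def complex_norm_square[symmetric]
  by (simp add: suminf_of_real summable_hcoeff)

text \<open>The underlying real Hilbert-space structure has inner product \<open>Re (hinner f g)\<close>; it induces
  the \<open>H\<^sup>2\<close> norm \<open>norm f = sqrt (\<Sum>n. |hcoeff f n|\<^sup>2)\<close> and the norm topology.\<close>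

instantiation hardy :: real_inner
begin

definition scaleR_hardy :: "real \<Rightarrow> hardy \<Rightarrow> hardy" where "scaleR_hardy r = hscale (of_real r)"
definition inner_hardy :: "hardy \<Rightarrow> hardy \<Rightarrow> real" where "inner_hardy f g = Re (hinner f g)"
definition norm_hardy :: "hardy \<Rightarrow> real" where "norm_hardy f = sqrt (inner f f)"
definition sgn_hardy :: "hardy \<Rightarrow> hardy" where "sgn_hardy f = scaleR (inverse (norm f)) f"
definition dist_hardy :: "hardy \<Rightarrow> hardy \<Rightarrow> real" where "dist_hardy f g = norm (f - g)"
definition uniformity_hardy :: "(hardy \<times> hardy) filter" where
  "uniformity_hardy = (INF e\<in>{0<..}. principal {(f, g). dist f g < e})"
definition open_hardy :: "hardy set \<Rightarrow> bool" where
  "open_hardy U = (\<forall>f\<in>U. eventually (\<lambda>(f', g). f' = f \<longrightarrow> g \<in> U) uniformity)"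

instance
proof
  fix f g h :: hardy and r s :: real and U :: "hardy set"
  show "r *\<^sub>R (f + g) = r *\<^sub>R f + r *\<^sub>R g" "(r + s) *\<^sub>R f = r *\<^sub>R f + s *\<^sub>R f"
    "r *\<^sub>R s *\<^sub>R f = (r * s) *\<^sub>R f" "1 *\<^sub>R f = f"
    by (simp_all add: scaleR_hardy_def hardy.scale_right_distrib hardy.scale_left_distrib)
  show "dist f g = norm (f - g)" by (rule dist_hardy_def)
  show "sgn f = scaleR (inverse (norm f)) f" by (rule sgn_hardy_def)
  show "uniformity = (INF e\<in>{0<..}. principal {(f::hardy, g). dist f g < e})"
    by (rule uniformity_hardy_def)
  show "open U = (\<forall>f\<in>U. eventually (\<lambda>(f', g). f' = f \<longrightarrow> g \<in> U) uniformity)"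
    by (rule open_hardy_def)
  show "norm f = sqrt (inner f f)" by (rule norm_hardy_def)
  show "inner f g = inner g f"
    using hinner_commute[of f g] by (simp add: inner_hardy_def)
  show "inner (f + g) h = inner f h + inner g h"
    by (simp add: inner_hardy_def hinner_add_left)
  show "inner (r *\<^sub>R f) g = r * inner f g"
    by (simp add: inner_hardy_def scaleR_hardy_def hinner_hscale_left)
  show "0 \<le> inner f f"
    by (simp add: inner_hardy_def hinner_self suminf_nonneg summable_hcoeff)
  show "inner f f = 0 \<longleftrightarrow> f = 0"
  proof
    assume "inner f f = 0"
    then have "hcoeff f n = 0" for n
      by (simp add: inner_hardy_def hinner_self suminf_eq_zero_iff summable_hcoeff)
    then show "f = 0" by (rule hcoeff_eq_0_imp)
  next
    assume "f = 0"
    then have "f = hscale 0 f" by simp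
    then have "hinner f f = 0" using hinner_hscale_left[of 0 f f] by simp
    then show "inner f f = 0" by (simp add: inner_hardy_def)
  qed
qed

end

text \<open>An operator on a subspace is a total function on \<^typ>\<open>hardy\<close> of which only the values on that
  subspace matter.\<close>

definition proj :: "hardy set \<Rightarrow> hardy \<Rightarrow> hardy" where
  "proj S f = (THE g. g \<in> S \<and> (\<forall>h\<in>S. hinner (f - g) h = 0))"

definition ortho_compl_in :: "hardy set \<Rightarrow> hardy set \<Rightarrow> hardy set" where
  "ortho_compl_in V S = {f \<in> V. \<forall>g\<in>S. hinner f g = 0}"

definition linear_operator_on :: "hardy set \<Rightarrow> (hardy \<Rightarrow> hardy) \<Rightarrow> bool" where
  "linear_operator_on V A \<longleftrightarrow> A ` V \<subseteq> V \<and>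
     (\<forall>f\<in>V. \<forall>g\<in>V. A (f + g) = A f + A g) \<and> (\<forall>c. \<forall>f\<in>V. A (hscale c f) = hscale c (A f))"

definition self_adjoint_on :: "hardy set \<Rightarrow> (hardy \<Rightarrow> hardy) \<Rightarrow> bool" where
  "self_adjoint_on V A \<longleftrightarrow> linear_operator_on V A \<and>
     (\<forall>f\<in>V. \<forall>g\<in>V. hinner (A f) g = hinner f (A g))"

definition op_norm_on :: "hardy set \<Rightarrow> (hardy \<Rightarrow> hardy) \<Rightarrow> real" where
  "op_norm_on V A = (SUP f\<in>{f \<in> V. norm f \<le> 1}. norm (A f))"

definition op_exp :: "(hardy \<Rightarrow> hardy) \<Rightarrow> hardy \<Rightarrow> hardy" where
  "op_exp A f = (\<Sum>k. (A ^^ k) f /\<^sub>R fact k)"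

text \<open>\<open>adjoint_from S T\<close> is the adjoint of \<open>T\<close> regarded as an operator with domain \<open>S\<close>; it takes
  values in \<open>S\<close>.\<close>

definition adjoint_from :: "hardy set \<Rightarrow> (hardy \<Rightarrow> hardy) \<Rightarrow> hardy \<Rightarrow> hardy" where
  "adjoint_from S T g = (THE h. h \<in> S \<and> (\<forall>f\<in>S. hinner (T f) g = hinner f h))"

text \<open>The singular values of \<open>T\<close> as an operator with finite-dimensional domain \<open>S\<close>, in decreasing
  order: the square roots of the eigenvalues of \<open>T\<^sup>*T\<close> on \<open>S\<close>, each repeated according to the
  complex dimension of its eigenspace.\<close>

definition singular_values :: "hardy set \<Rightarrow> (hardy \<Rightarrow> hardy) \<Rightarrow> real list" where
  "singular_values S T = (THE xs. sorted_wrt (\<ge>) xs \<and>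
     (\<forall>s. count_list xs s =
        (if 0 \<le> s then hardy.dim {f \<in> S. adjoint_from S T (T f) = hscale (of_real (s\<^sup>2)) f} else 0)))"

text \<open>Indices start at \<open>0\<close>, so \<open>singular_value S T 0\<close> is the largest one and the smallest has index
  \<open>dim S - 1\<close>.\<close>

definition singular_value :: "hardy set \<Rightarrow> (hardy \<Rightarrow> hardy) \<Rightarrow> nat \<Rightarrow> real" where
  "singular_value S T k = singular_values S T ! k"

definition blaschke_factor :: "complex \<Rightarrow> complex \<Rightarrow> complex" where
  "blaschke_factor a z =
     (if a = 0 then z else cnj a / of_real (cmod a) * ((a - z) / (1 - cnj a * z)))"

definition blaschke :: "complex set \<Rightarrow> complex \<Rightarrow> complex" where
  "blaschke A z = (\<Prod>a\<in>A. blaschke_factor a z)"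

definition kernel_space :: "complex set \<Rightarrow> complex set \<Rightarrow> hardy set" where
  "kernel_space A B = hardy.span (szego ` (A \<union> B))"

text \<open>\<open>vanishing_space A B A\<close> and \<open>vanishing_space A B B\<close> are the subspaces of \<open>kernel_space A B\<close>
  of functions vanishing on \<open>A\<close> and on \<open>B\<close>, respectively.\<close>

definition vanishing_space :: "complex set \<Rightarrow> complex set \<Rightarrow> complex set \<Rightarrow> hardy set" where
  "vanishing_space A B C = {f \<in> kernel_space A B. \<forall>c\<in>C. hardy_fun f c = 0}"

text \<open>\<open>X\<close> is the exponent of the minimal geodesic from \<open>S\<close> to \<open>S'\<close> inside \<open>V\<close>. When \<open>S\<close> and \<open>S'\<close> are in
  generic position in \<open>V\<close>, these conditions determine \<open>X\<close> uniquely on \<open>V\<close> (its values off \<open>V\<close> are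
  arbitrary), which is why this is a predicate on \<open>X\<close>.\<close>

definition geodesic_exponent :: "hardy set \<Rightarrow> hardy set \<Rightarrow> hardy set \<Rightarrow> (hardy \<Rightarrow> hardy) \<Rightarrow> bool" where
  "geodesic_exponent V S S' X \<longleftrightarrow>
     self_adjoint_on V X \<and> op_norm_on V X \<le> pi / 2 \<and>
     X ` S \<subseteq> ortho_compl_in V S \<and> X ` ortho_compl_in V S \<subseteq> S \<and>
     op_exp (\<lambda>f. hscale \<i> (X f)) ` S = S'"

end

theory Submission
  imports Defs "HOL-Computational_Algebra.Fundamental_Theorem_Algebra"
begin

text \<open>Let \<open>k\<close> be the kernel at a point \<open>w\<close> of \<open>B\<close> and \<open>h\<close> its projection onto \<open>Za\<close>; then
  \<open>\<langle>h, k\<rangle> = \<parallel>h\<parallel>\<^sup>2 = |B\<^sub>A(w)|\<^sup>2 \<parallel>k\<parallel>\<^sup>2\<close>. Every \<open>g\<close> in \<open>Zb\<close> is orthogonal to \<open>k\<close>, so if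
  \<open>|\<langle>h, g\<rangle>| \<ge> C \<parallel>h\<parallel> \<parallel>g\<parallel>\<close> for some such \<open>g \<noteq> 0\<close>, the Cauchy-Schwarz inequality for
  \<open>h - |B\<^sub>A(w)|\<^sup>2 k\<close> and \<open>g\<close> gives \<open>C\<^sup>2 + |B\<^sub>A(w)|\<^sup>2 \<le> 1\<close>. For the singular values such a \<open>g\<close> exists
  with \<open>C = s\<^sub>n\<^sub>-\<^sub>1\<close>, as the projection from \<open>Zb\<close> to \<open>Za\<close> is onto when \<open>C > 0\<close>. For the
  geodesic, \<open>g = e\<^sup>i\<^sup>X h\<close> works with \<open>C = cos \<parallel>X\<parallel>\<close>.\<close>

section \<open>The inner product\<close>

lemma hinner_add_right: "hinner f (g + h) = hinner f g + hinner f h"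
  by (metis hinner_add_left hinner_commute complex_cnj_add)

lemma hinner_hscale_right: "hinner f (hscale c g) = cnj c * hinner f g"
  by (metis hinner_hscale_left hinner_commute complex_cnj_mult)

lemma hinner_zero_left [simp]: "hinner 0 g = 0"
  using hinner_hscale_left[of 0 0 g] by simp

lemma hinner_zero_right [simp]: "hinner f 0 = 0"
  using hinner_commute[of f 0] by simp

lemma hinner_diff_left: "hinner (f - g) h = hinner f h - hinner g h"
  using hinner_add_left[of "f - g" g h] by simp

lemma hinner_diff_right: "hinner h (f - g) = hinner h f - hinner h g"
  using hinner_add_right[of h "f - g" g] by simp

lemma hinner_sum_left: "hinner (sum f I) h = (\<Sum>i\<in>I. hinner (f i) h)"
  by (induction I rule: infinite_finite_induct) (auto simp: hinner_add_left)

lemma hinner_sum_right: "hinner h (sum f I) = (\<Sum>i\<in>I. hinner h (f i))"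
  by (induction I rule: infinite_finite_induct) (auto simp: hinner_add_right)

lemma hinner_norm: "hinner f f = of_real ((norm f)\<^sup>2)"
proof -
  have "(norm f)\<^sup>2 = Re (hinner f f)"
    by (metis inner_hardy_def power2_norm_eq_inner)
  then show ?thesis by (simp add: hinner_self)
qed

lemma hinner_self_eq_0_iff [simp]: "hinner f f = 0 \<longleftrightarrow> f = 0"
  by (simp add: hinner_norm)

lemma hinner_eq_0_commute: "hinner f g = 0 \<longleftrightarrow> hinner g f = 0"
  by (metis hinner_commute complex_cnj_zero)

lemma norm_hscale: "norm (hscale c f) = cmod c * norm f"
proof -
  have "hinner (hscale c f) (hscale c f) = (c * cnj c) * hinner f f"
    by (simp add: hinner_hscale_left hinner_hscale_right)
  also have "\<dots> = of_real ((cmod c * norm f)\<^sup>2)"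
    by (simp add: hinner_norm complex_norm_square[symmetric] power_mult_distrib)
  finally have "complex_of_real ((norm (hscale c f))\<^sup>2) = of_real ((cmod c * norm f)\<^sup>2)"
    by (simp only: hinner_norm)
  then show ?thesis
    by (metis of_real_eq_iff norm_ge_zero power2_eq_imp_eq mult_nonneg_nonneg)
qed

text \<open>The inequality of the real structure bounds only the real part of \<open>hinner\<close>.
  Multiplying \<open>f\<close> by the unimodular \<open>u\<close> turns \<open>hinner f g\<close>
  into its modulus and keeps the norm of \<open>f\<close>.\<close>

lemma hinner_Cauchy_Schwarz: "cmod (hinner f g) \<le> norm f * norm g"
proof (cases "hinner f g = 0")
  case False
  define u where "u = cnj (hinner f g) / of_real (cmod (hinner f g))"
  have "hinner (hscale u f) g = of_real (cmod (hinner f g))"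
    using False complex_norm_square[of "hinner f g"]
    by (simp add: u_def hinner_hscale_left field_simps power2_eq_square)
  then have "cmod (hinner f g) = inner (hscale u f) g"
    by (simp add: inner_hardy_def)
  also have "\<dots> \<le> norm (hscale u f) * norm g"
    by (rule norm_cauchy_schwarz)
  also have "norm (hscale u f) = norm f"
    using False by (simp add: norm_hscale u_def norm_divide)
  finally show ?thesis .
qed auto

lemma hinner_span_eq_0:
  assumes "\<And>e. e \<in> E \<Longrightarrow> hinner g e = 0" "f \<in> hardy.span E"
  shows "hinner g f = 0"
  using assms(2)
  by (induction rule: hardy.span_induct_alt)
     (auto simp: hinner_add_right hinner_hscale_right assms(1))

section \<open>Orthonormal bases and the spectral theorem on finite-dimensional subspaces\<close>

definition orthonormal :: "hardy set \<Rightarrow> bool" where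
  "orthonormal E \<longleftrightarrow> (\<forall>e\<in>E. \<forall>f\<in>E. hinner e f = (if e = f then 1 else 0))"

definition orthonormal_basis :: "hardy set \<Rightarrow> hardy set \<Rightarrow> bool" where
  "orthonormal_basis V E \<longleftrightarrow> finite E \<and> orthonormal E \<and> hardy.span E = V"

text \<open>The finite spanning set need not lie in \<open>V\<close>, so every subspace of such a
  \<open>V\<close> inherits the property at once.\<close>

definition fin_dim_subspace :: "hardy set \<Rightarrow> bool" where
  "fin_dim_subspace V \<longleftrightarrow> hardy.subspace V \<and> (\<exists>F. finite F \<and> V \<subseteq> hardy.span F)"

lemma orthonormal_norm: "orthonormal E \<Longrightarrow> e \<in> E \<Longrightarrow> norm e = 1"
proof -
  assume "orthonormal E" "e \<in> E"
  then have "hinner e e = 1" by (auto simp: orthonormal_def)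
  then have "(norm e)\<^sup>2 = 1"
    unfolding hinner_norm by (metis of_real_eq_1_iff)
  then show ?thesis by (simp add: power2_eq_1_iff)
      (smt (verit) norm_ge_zero)
qed

lemma orthonormal_independent:
  assumes "orthonormal E" shows "hardy.independent E"
proof
  assume "hardy.dependent E"
  then obtain e where e: "e \<in> E" "e \<in> hardy.span (E - {e})"
    by (auto simp: hardy.dependent_def)
  have "hinner e e = 0"
    by (rule hinner_span_eq_0[OF _ e(2)]) (use assms e(1) in \<open>auto simp: orthonormal_def\<close>)
  moreover have "hinner e e = 1" using assms e(1) by (auto simp: orthonormal_def)
  ultimately show False by (metis zero_neq_one)
qed

lemma hinner_orthonormal_sum:
  assumes "finite E" "orthonormal E" "e \<in> E"
  shows "hinner (\<Sum>x\<in>E. hscale (u x) x) e = u e"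
proof -
  have "hinner (\<Sum>x\<in>E. hscale (u x) x) e = (\<Sum>x\<in>E. if x = e then u e else 0)"
    unfolding hinner_sum_left
    by (rule sum.cong) (use assms in \<open>auto simp: hinner_hscale_left orthonormal_def\<close>)
  also have "\<dots> = u e" using assms by simp
  finally show ?thesis .
qed

lemma hinner_orthonormal_sums:
  assumes "finite E" "orthonormal E"
  shows "hinner (\<Sum>x\<in>E. hscale (u x) x) (\<Sum>x\<in>E. hscale (v x) x) = (\<Sum>x\<in>E. u x * cnj (v x))"
proof -
  have "hinner (\<Sum>x\<in>E. hscale (u x) x) (\<Sum>x\<in>E. hscale (v x) x) =
        (\<Sum>y\<in>E. cnj (v y) * hinner (\<Sum>x\<in>E. hscale (u x) x) y)"
    by (simp add: hinner_sum_right hinner_hscale_right)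
  also have "\<dots> = (\<Sum>x\<in>E. u x * cnj (v x))"
    by (rule sum.cong) (simp_all add: hinner_orthonormal_sum[OF assms])
  finally show ?thesis .
qed

lemma norm_orthonormal_sum:
  assumes "finite E" "orthonormal E"
  shows "(norm (\<Sum>x\<in>E. hscale (u x) x))\<^sup>2 = (\<Sum>x\<in>E. (cmod (u x))\<^sup>2)"
proof -
  have "complex_of_real ((norm (\<Sum>x\<in>E. hscale (u x) x))\<^sup>2) = of_real (\<Sum>x\<in>E. (cmod (u x))\<^sup>2)"
    unfolding hinner_norm[symmetric] hinner_orthonormal_sums[OF assms]
    by (simp add: complex_norm_square[symmetric])
  then show ?thesis by (metis of_real_eq_iff)
qed

text \<open>As \<open>f\<close> is arbitrary, the Fourier sum is the orthogonal projection of
  \<open>f\<close> onto the span. This later produces \<open>proj\<close> and, in the spectral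
  theorem, a vector orthogonal to \<open>E\<close>.\<close>

lemma orthonormal_residual:
  assumes "finite E" "orthonormal E" "g \<in> hardy.span E"
  shows "hinner (f - (\<Sum>e\<in>E. hscale (hinner f e) e)) g = 0"
  by (rule hinner_span_eq_0[OF _ assms(3)])
     (simp add: hinner_diff_left hinner_orthonormal_sum[OF assms(1,2)])

lemma orthonormal_sum_in_span: "(\<Sum>e\<in>E. hscale (u e) e) \<in> hardy.span E"
  by (intro hardy.span_sum hardy.span_scale hardy.span_base)

lemma orthonormal_expansion:
  assumes "finite E" "orthonormal E" "f \<in> hardy.span E"
  shows "f = (\<Sum>e\<in>E. hscale (hinner f e) e)"
proof -
  let ?g = "f - (\<Sum>e\<in>E. hscale (hinner f e) e)"
  have "?g \<in> hardy.span E"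
    using assms(3) orthonormal_sum_in_span by (rule hardy.span_diff)
  then have "hinner ?g ?g = 0" by (rule orthonormal_residual[OF assms(1,2)])
  then show ?thesis by simp
qed

lemma orthonormal_basis_expansion:
  assumes "orthonormal_basis V E" "f \<in> V"
  shows "f = (\<Sum>e\<in>E. hscale (hinner f e) e)"
  using assms orthonormal_expansion unfolding orthonormal_basis_def by blast

section \<open>Eigenvectors from annihilating polynomials\<close>

lemma linear_operator_on_pow:
  assumes "linear_operator_on V A" "f \<in> V"
  shows "(A ^^ i) f \<in> V"
  using assms by (induction i) (auto simp: linear_operator_on_def)

lemma linear_operator_on_pow_diff:
  assumes A: "linear_operator_on V A" and V: "hardy.subspace V" and f: "f \<in> V"
  shows "(A ^^ i) (A f - hscale z f) = (A ^^ Suc i) f - hscale z ((A ^^ i) f)"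
proof (induction i)
  case (Suc i)
  have 1: "A (g - hscale z h) = A g - hscale z (A h)" if "g \<in> V" "h \<in> V" for g h
  proof -
    have "A (g + hscale (-z) h) = A g + hscale (-z) (A h)"
      using A that hardy.subspace_scale[OF V that(2)] unfolding linear_operator_on_def by metis
    then show ?thesis by simp
  qed
  show ?case
    using Suc 1[OF linear_operator_on_pow[OF A f, of "Suc i"] linear_operator_on_pow[OF A f, of i]]
    by simp
qed simp

lemma linear_operator_on_sum:
  assumes A: "linear_operator_on V A" and V: "hardy.subspace V"
    and f: "\<And>i. i \<in> I \<Longrightarrow> f i \<in> V"
  shows "A (\<Sum>i\<in>I. hscale (u i) (f i)) = (\<Sum>i\<in>I. hscale (u i) (A (f i)))"
  using f
proof (induction I rule: infinite_finite_induct)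
  case (insert i I)
  have "(\<Sum>i\<in>I. hscale (u i) (f i)) \<in> V"
    by (intro hardy.subspace_sum[OF V] hardy.subspace_scale[OF V]) (use insert in auto)
  moreover have "hscale (u i) (f i) \<in> V"
    by (intro hardy.subspace_scale[OF V]) (use insert in auto)
  ultimately show ?case
    using A insert unfolding linear_operator_on_def by simp
next
  have "A (hscale 0 0) = hscale 0 (A 0)"
    using A hardy.subspace_0[OF V] unfolding linear_operator_on_def by blast
  then have "A 0 = 0" by simp
  { case (infinite I) with \<open>A 0 = 0\<close> show ?case by simp }
  { case empty with \<open>A 0 = 0\<close> show ?case by simp }
qed

text \<open>Induction on the degree: split off a root, \<open>p = (X - z) q\<close>, and put
  \<open>w = A v - z v\<close>. If \<open>w = 0\<close>, then \<open>v\<close> is an eigenvector;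
  otherwise \<open>q(A)\<close> annihilates the nonzero vector \<open>w\<close> and has smaller
  degree.\<close>

lemma eigenvector_of_annihilating_poly:
  assumes A: "linear_operator_on V A" and V: "hardy.subspace V"
  shows "v \<in> V \<Longrightarrow> v \<noteq> 0 \<Longrightarrow> p \<noteq> 0 \<Longrightarrow> (\<Sum>i\<le>degree p. hscale (coeff p i) ((A ^^ i) v)) = 0
     \<Longrightarrow> \<exists>w z. w \<in> V \<and> w \<noteq> 0 \<and> A w = hscale z w"
proof (induction "degree p" arbitrary: p v)
  case 0
  then obtain c where "p = [:c:]" by (metis degree_eq_zeroE)
  with 0 show ?case by simp
next
  case (Suc d)
  obtain z where "poly p z = 0"
    using Fundamental_Theorem_Algebra.fundamental_theorem_of_algebra[of p] Suc.hyps(2) by (auto simp: constant_degree)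
  then obtain q where q: "p = [:-z, 1:] * q" by (metis poly_eq_0_iff_dvd dvdE)
  have q0: "q \<noteq> 0" using Suc.prems(3) q by auto
  have dq: "degree p = Suc (degree q)"
    using q q0 by (simp add: degree_mult_eq del: mult_pCons_left)
  define w where "w = A v - hscale z v"
  show ?case
  proof (cases "w = 0")
    case True
    then show ?thesis using Suc.prems by (intro exI[of _ v] exI[of _ z]) (auto simp: w_def)
  next
    case False
    have "A v \<in> V" using A Suc.prems by (auto simp: linear_operator_on_def)
    then have wV: "w \<in> V"
      unfolding w_def using V Suc.prems by (intro hardy.subspace_diff hardy.subspace_scale)
    define g where "g i = (A ^^ i) v" for i
    have "(\<Sum>i\<le>degree q. hscale (coeff q i) ((A ^^ i) w)) =
          (\<Sum>i\<le>degree q. hscale (coeff q i) (g (Suc i))) - (\<Sum>i\<le>degree q. hscale (z * coeff q i) (g i))"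
      unfolding w_def linear_operator_on_pow_diff[OF A V Suc.prems(1)]
      by (simp add: g_def hardy.scale_right_diff_distrib sum_subtractf mult.commute del: funpow.simps)
    \<comment> \<open>The added top term has coefficient 0. Below, multiplication of
      \<open>q\<close> by \<open>X\<close> becomes an index shift, so that both sums run up to
      \<open>degree p\<close> and combine to the coefficients of \<open>p\<close>.\<close>
    also have "(\<Sum>i\<le>degree q. hscale (z * coeff q i) (g i)) =
               (\<Sum>i\<le>degree p. hscale (z * coeff q i) (g i))"
      using dq by (simp add: coeff_eq_0)
    also have "(\<Sum>i\<le>degree q. hscale (coeff q i) (g (Suc i))) =
               (\<Sum>i\<le>degree p. hscale (case i of 0 \<Rightarrow> 0 | Suc j \<Rightarrow> coeff q j) (g i))"
      unfolding dq sum.atMost_Suc_shift by simp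
    also have "\<dots> - (\<Sum>i\<le>degree p. hscale (z * coeff q i) (g i)) =
               (\<Sum>i\<le>degree p. hscale (coeff p i) (g i))"
      unfolding sum_subtractf[symmetric]
      by (rule sum.cong)
         (auto simp: q coeff_pCons algebra_simps hardy.scale_left_diff_distrib split: nat.splits)
    finally have "(\<Sum>i\<le>degree q. hscale (coeff q i) ((A ^^ i) w)) = 0"
      using Suc.prems(4) by (simp add: g_def)
    then show ?thesis
      using Suc.hyps(1)[of q w] Suc.hyps(2) dq False wV q0 by simp
  qed
qed

text \<open>The \<open>card F + 1\<close> vectors \<open>v, A v, ...\<close> lie in the span of
  \<open>card F\<close> vectors. A nontrivial linear relation between them is an annihilating
  polynomial for \<open>v\<close>.\<close>

lemma eigenvector_exists:
  assumes A: "linear_operator_on V A" and V: "fin_dim_subspace V" and v: "v \<in> V" "v \<noteq> 0"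
  shows "\<exists>w z. w \<in> V \<and> w \<noteq> 0 \<and> A w = hscale z w"
proof -
  from V obtain F where sV: "hardy.subspace V" and F: "finite F" "V \<subseteq> hardy.span F"
    by (auto simp: fin_dim_subspace_def)
  define g where "g i = (A ^^ i) v" for i
  define I where "I = {..card F}"
  have gV: "g i \<in> V" for i
    unfolding g_def by (rule linear_operator_on_pow[OF A v(1)])
  obtain u where u: "(\<Sum>i\<in>I. hscale (u i) (g i)) = 0" "\<exists>i\<in>I. u i \<noteq> 0"
  \<comment> \<open>Dependence is a notion for sets, so repetitions among the powers are treated
    apart: they give the relation \<open>g i - g j = 0\<close> directly.\<close>
  proof (cases "inj_on g I")
    case True
    have "hardy.dependent (g ` I)"
    proof (rule ccontr)
      assume "hardy.independent (g ` I)"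
      then have "card (g ` I) \<le> card F"
        using hardy.independent_span_bound[OF F(1)] F(2) gV by blast
      then show False using True by (simp add: card_image I_def)
    qed
    then obtain u where "\<exists>x\<in>g ` I. u x \<noteq> 0" "(\<Sum>x\<in>g ` I. hscale (u x) x) = 0"
      using hardy.dependent_finite[of "g ` I"] by (auto simp: I_def)
    then show ?thesis
      using that[of "u \<circ> g"] by (simp add: sum.reindex[OF True] o_def)
  next
    case False
    then obtain i j where ij: "i \<in> I" "j \<in> I" "i \<noteq> j" "g i = g j"
      by (auto simp: inj_on_def)
    define u :: "nat \<Rightarrow> complex" where "u k = (if k = i then 1 else if k = j then -1 else 0)" for k
    have "(\<Sum>k\<in>I. hscale (u k) (g k)) = (\<Sum>k\<in>{i, j}. hscale (u k) (g k))"
      by (rule sum.mono_neutral_right) (use ij in \<open>auto simp: I_def u_def\<close>)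
    also have "\<dots> = 0" using ij by (simp add: u_def)
    finally have "(\<Sum>k\<in>I. hscale (u k) (g k)) = 0" .
    moreover have "u i \<noteq> 0" by (simp add: u_def)
    ultimately show ?thesis using that[of u] ij(1) by blast
  qed
  define p where "p = (\<Sum>i\<in>I. monom (u i) i)"
  have cp: "coeff p i = (if i \<in> I then u i else 0)" for i
    by (auto simp: p_def coeff_sum I_def)
  have "p \<noteq> 0" using u(2) cp by (metis coeff_0)
  moreover have "degree p \<le> card F"
    by (rule degree_le) (auto simp: cp I_def)
  then have "(\<Sum>i\<le>degree p. hscale (coeff p i) (g i)) = (\<Sum>i\<in>I. hscale (coeff p i) (g i))"
    by (intro sum.mono_neutral_left) (auto simp: I_def coeff_eq_0)
  then have "(\<Sum>i\<le>degree p. hscale (coeff p i) (g i)) = 0"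
    using u(1) cp by simp
  ultimately show ?thesis
    using eigenvector_of_annihilating_poly[OF A sV v] unfolding g_def by blast
qed

text \<open>Take an orthonormal set of eigenvectors of maximal cardinality. If it did not span
  \<open>V\<close>, its orthogonal complement \<open>W\<close> in \<open>V\<close> would be nonzero
  and, by self-adjointness, invariant under \<open>A\<close>; a normalised eigenvector in
  \<open>W\<close> would enlarge the set.\<close>

theorem spectral_theorem:
  assumes V: "fin_dim_subspace V" and A: "self_adjoint_on V A"
  obtains E r where "orthonormal_basis V E" "\<And>e. e \<in> E \<Longrightarrow> A e = hscale (of_real (r e)) e"
proof -
  from V obtain F where sV: "hardy.subspace V" and F: "finite F" "V \<subseteq> hardy.span F"
    by (auto simp: fin_dim_subspace_def)
  have lA: "linear_operator_on V A" and sa: "\<And>f g. f \<in> V \<Longrightarrow> g \<in> V \<Longrightarrow> hinner (A f) g = hinner f (A g)"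
    using A by (auto simp: self_adjoint_on_def)
  \<comment> \<open>Eigenvalues are allowed to be complex here; that they are real is derived at the
    end from \<open>hinner (A e) e = hinner e (A e)\<close>.\<close>
  define P where "P E \<longleftrightarrow> finite E \<and> E \<subseteq> V \<and> orthonormal E \<and> (\<forall>e\<in>E. \<exists>z. A e = hscale z e)" for E
  have bound: "card E \<le> card F" if "P E" for E
    using hardy.independent_span_bound[OF F(1) orthonormal_independent[of E]] that F(2)
    by (auto simp: P_def)
  have "P {}" by (simp add: P_def orthonormal_def)
  then obtain E where E: "P E" "\<And>E'. P E' \<Longrightarrow> card E' \<le> card E"
    using ex_has_greatest_nat[of P "{}" card "Suc (card F)"] bound
    by (metis less_Suc_eq_le)
  then have fE: "finite E" and EV: "E \<subseteq> V" and oE: "orthonormal E"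
    and eE: "\<And>e. e \<in> E \<Longrightarrow> \<exists>z. A e = hscale z e"
    by (auto simp: P_def)
  have "hardy.span E = V"
  proof (rule ccontr)
    assume "hardy.span E \<noteq> V"
    moreover have "hardy.span E \<subseteq> V" using EV sV by (rule hardy.span_minimal)
    ultimately obtain f where f: "f \<in> V" "f \<notin> hardy.span E" by blast
    define W where "W = {g \<in> V. \<forall>e\<in>E. hinner g e = 0}"
    define v where "v = f - (\<Sum>e\<in>E. hscale (hinner f e) e)"
    have "v \<noteq> 0" using f(2) orthonormal_sum_in_span[of "hinner f" E] by (auto simp: v_def)
    have "(\<Sum>e\<in>E. hscale (hinner f e) e) \<in> V"
      using \<open>hardy.span E \<subseteq> V\<close> orthonormal_sum_in_span by blast
    then have "v \<in> W"
      using hardy.subspace_diff[OF sV f(1)] orthonormal_residual[OF fE oE hardy.span_base]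
      by (auto simp: W_def v_def)
    have sW: "hardy.subspace W"
      using sV unfolding W_def hardy.subspace_def
      by (auto simp: hinner_add_left hinner_hscale_left)
    then have fW: "fin_dim_subspace W"
      using F unfolding fin_dim_subspace_def W_def by blast
    have "A g \<in> W" if "g \<in> W" for g
    proof -
      have "hinner (A g) e = 0" if "e \<in> E" for e
      proof -
        obtain z where z: "A e = hscale z e" using eE \<open>e \<in> E\<close> by blast
        have "hinner (A g) e = hinner g (A e)"
          using \<open>g \<in> W\<close> \<open>e \<in> E\<close> EV sa by (auto simp: W_def)
        then show ?thesis
          using \<open>g \<in> W\<close> \<open>e \<in> E\<close> by (simp add: z hinner_hscale_right W_def)
      qed
      then show ?thesis using that lA by (auto simp: W_def linear_operator_on_def)
    qed
    then have "linear_operator_on W A"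
      using lA unfolding linear_operator_on_def W_def by blast
    from eigenvector_exists[OF this fW \<open>v \<in> W\<close> \<open>v \<noteq> 0\<close>]
    obtain w z where w: "w \<in> W" "w \<noteq> 0" "A w = hscale z w" by blast
    define w' where "w' = hscale (of_real (inverse (norm w))) w"
    have w'W: "w' \<in> W" unfolding w'_def using sW w(1) by (rule hardy.subspace_scale)
    have nw': "norm w' = 1" using w(2) by (simp add: w'_def norm_hscale norm_inverse)
    have "A w' = hscale z w'"
      using lA w unfolding w'_def linear_operator_on_def W_def by (simp add: mult.commute)
    moreover have hw': "hinner w' w' = 1" by (simp add: hinner_norm nw')
    moreover have h0: "hinner w' e = 0" "hinner e w' = 0" if "e \<in> E" for e
      using w'W that hinner_eq_0_commute by (auto simp: W_def)
    have nin: "w' \<notin> E" using hw' h0 by fastforce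
    moreover have "orthonormal (insert w' E)"
      using oE hw' h0 nin by (auto simp: orthonormal_def)
    ultimately have "P (insert w' E)"
      using E(1) w'W by (auto simp: P_def W_def)
    then show False using E(2) nin fE by fastforce
  qed
  then have "orthonormal_basis V E" using fE oE by (simp add: orthonormal_basis_def)
  moreover have "\<exists>r::real. A e = hscale (of_real r) e" if e: "e \<in> E" for e
  proof -
    obtain z where z: "A e = hscale z e" using eE[OF e] by blast
    have "hinner (A e) e = hinner e (A e)" using e EV sa by blast
    moreover have "hinner e e = 1" using oE e by (auto simp: orthonormal_def)
    ultimately have "z = cnj z" by (simp add: z hinner_hscale_left hinner_hscale_right)
    then have "z = of_real (Re z)" by (simp add: complex_eq_iff)
    then show ?thesis using z by metis
  qed
  then obtain r where "\<And>e. e \<in> E \<Longrightarrow> A e = hscale (of_real (r e)) e" by metis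
  ultimately show ?thesis by (rule that)
qed

text \<open>An eigenbasis of the identity operator.\<close>

lemma orthonormal_basis_exists:
  assumes "fin_dim_subspace V" obtains E where "orthonormal_basis V E"
proof -
  have "self_adjoint_on V (\<lambda>f. f)" by (auto simp: self_adjoint_on_def linear_operator_on_def)
  with assms show ?thesis using spectral_theorem that by metis
qed

lemma orthonormal_basis_dim: "orthonormal_basis V E \<Longrightarrow> hardy.dim V = card E"
  unfolding orthonormal_basis_def
  by (metis hardy.dim_eq_card_independent hardy.dim_span orthonormal_independent)

section \<open>Orthogonal projections\<close>

text \<open>Uniqueness for the definite description in \<open>proj\<close>: the difference of two
  candidates lies in \<open>V\<close> and is orthogonal to \<open>V\<close>, hence to
  itself.\<close>

lemma proj_eqI:
  assumes "hardy.subspace V" "g \<in> V" "\<And>h. h \<in> V \<Longrightarrow> hinner (f - g) h = 0"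
  shows "proj V f = g"
  unfolding proj_def
proof (rule the_equality)
  fix g' assume g': "g' \<in> V \<and> (\<forall>h\<in>V. hinner (f - g') h = 0)"
  have "g - g' \<in> V" using assms g' by (auto intro: hardy.subspace_diff)
  then have "hinner (f - g') (g - g') - hinner (f - g) (g - g') = 0"
    using assms g' by simp
  then have "hinner (g - g') (g - g') = 0" by (simp add: hinner_diff_left)
  then show "g' = g" by simp
qed (use assms in auto)

lemma
  assumes "fin_dim_subspace V"
  shows proj_in: "proj V f \<in> V"
    and proj_residual: "h \<in> V \<Longrightarrow> hinner (f - proj V f) h = 0"
proof -
  obtain E where E: "orthonormal_basis V E" using orthonormal_basis_exists[OF assms] .
  then have fE: "finite E" "orthonormal E" and V: "hardy.span E = V"
    by (auto simp: orthonormal_basis_def)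
  let ?g = "\<Sum>e\<in>E. hscale (hinner f e) e"
  have g: "?g \<in> V" using orthonormal_sum_in_span V by blast
  have r: "hinner (f - ?g) h = 0" if "h \<in> V" for h
    using orthonormal_residual[OF fE] that V by blast
  have "proj V f = ?g"
    using assms g r by (intro proj_eqI) (auto simp: fin_dim_subspace_def)
  with g r show "proj V f \<in> V" "h \<in> V \<Longrightarrow> hinner (f - proj V f) h = 0" by simp_all
qed

lemma hinner_proj_left:
  assumes "fin_dim_subspace V" "h \<in> V"
  shows "hinner (proj V f) h = hinner f h"
  using proj_residual[OF assms, of f] by (simp add: hinner_diff_left)

lemma hinner_proj_right:
  assumes "fin_dim_subspace V" "h \<in> V"
  shows "hinner h (proj V f) = hinner h f"
  using hinner_proj_left[OF assms] hinner_commute by metis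

lemma proj_fixes:
  assumes "fin_dim_subspace V" "f \<in> V" shows "proj V f = f"
  using assms by (intro proj_eqI) (auto simp: fin_dim_subspace_def)

lemma proj_add:
  assumes "fin_dim_subspace V" shows "proj V (f + g) = proj V f + proj V g"
proof (rule proj_eqI)
  show sV: "hardy.subspace V" using assms by (simp add: fin_dim_subspace_def)
  show "proj V f + proj V g \<in> V" by (intro hardy.subspace_add sV proj_in assms)
qed (use hinner_proj_left[OF assms] in \<open>simp add: hinner_diff_left hinner_add_left\<close>)

lemma proj_hscale:
  assumes "fin_dim_subspace V" shows "proj V (hscale c f) = hscale c (proj V f)"
proof (rule proj_eqI)
  show sV: "hardy.subspace V" using assms by (simp add: fin_dim_subspace_def)
  show "hscale c (proj V f) \<in> V" by (intro hardy.subspace_scale sV proj_in assms)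
qed (use hinner_proj_left[OF assms] in \<open>simp add: hinner_diff_left hinner_hscale_left\<close>)

section \<open>Reproducing kernels and Blaschke products\<close>

lemma hardy_fun_add: "hardy_fun (f + g) z = hardy_fun f z + hardy_fun g z"
  by (simp add: plus_hardy.rep_eq)

lemma hardy_fun_hscale: "hardy_fun (hscale c f) z = c * hardy_fun f z"
  by (simp add: hscale.rep_eq)

lemma hardy_fun_diff: "hardy_fun (f - g) z = hardy_fun f z - hardy_fun g z"
  using hardy_fun_add[of "f - g" g z] by simp

lemma hardy_fun_zero: "hardy_fun 0 z = 0"
  by (simp add: zero_hardy.rep_eq)

lemma hardy_fun_szego:
  "cmod w < 1 \<Longrightarrow> cmod z < 1 \<Longrightarrow> hardy_fun (szego w) z = 1 / (1 - cnj w * z)"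
  by (simp add: szego.rep_eq)

lemma szego_denominator_nonzero: "cmod w < 1 \<Longrightarrow> cmod z < 1 \<Longrightarrow> 1 - cnj w * z \<noteq> 0"
proof
  assume "cmod w < 1" "cmod z < 1" "1 - cnj w * z = 0"
  then have "cmod w * cmod z = 1"
    by (metis complex_mod_cnj eq_iff_diff_eq_0 norm_mult norm_one)
  moreover have "cmod w * cmod z < 1 * 1"
    using \<open>cmod w < 1\<close> \<open>cmod z < 1\<close> by (intro mult_strict_mono') auto
  ultimately show False by simp
qed

text \<open>The reproducing property: the kernel has coefficients \<open>cnj w ^ n\<close>, so the
  inner product is the Taylor series of \<open>f\<close> evaluated at \<open>w\<close>.\<close>

lemma hinner_szego:
  assumes "cmod w < 1" shows "hinner f (szego w) = hardy_fun f w"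
proof -
  have "hardy_fun f holomorphic_on ball 0 1"
    using hardy_fun[of f] by (simp add: hardy_set_def)
  then have "(\<lambda>n. (deriv ^^ n) (hardy_fun f) 0 / fact n * (w - 0) ^ n) sums hardy_fun f w"
    by (rule holomorphic_power_series) (use assms in simp)
  then have "(\<lambda>n. hcoeff f n * cnj (hcoeff (szego w) n)) sums hardy_fun f w"
    using assms by (simp add: hcoeff.rep_eq taylor_coeff_def hcoeff_szego[unfolded hcoeff.rep_eq taylor_coeff_def])
  then show ?thesis unfolding hinner_def by (rule sums_unique[symmetric])
qed

lemma hcoeff_zero: "hcoeff 0 n = 0"
  using hcoeff_hscale[of 0 0 n] by simp

lemma hcoeff_sum: "hcoeff (sum f I) n = (\<Sum>i\<in>I. hcoeff (f i) n)"
  by (induction I rule: infinite_finite_induct) (auto simp: hcoeff_add hcoeff_zero)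

text \<open>A Vandermonde argument. Comparing Taylor coefficients, the weights \<open>u w\<close> at
  the points \<open>cnj w\<close> annihilate every power and hence every polynomial; one that
  vanishes at all these points except \<open>cnj v\<close> isolates \<open>u v\<close>.\<close>

lemma szego_combination_eq_0:
  assumes W: "finite W" "W \<subseteq> ball 0 1" and 0: "(\<Sum>w\<in>W. hscale (u w) (szego w)) = 0" and "v \<in> W"
  shows "u v = 0"
proof -
  define p where "p = (\<Prod>w\<in>W - {v}. [:- cnj w, 1:])"
  have *: "(\<Sum>w\<in>W. u w * cnj w ^ i) = 0" for i
  proof -
    have "(\<Sum>w\<in>W. u w * cnj w ^ i) = hcoeff (\<Sum>w\<in>W. hscale (u w) (szego w)) i"
      unfolding hcoeff_sum
      by (rule sum.cong) (use W in \<open>auto simp: hcoeff_hscale hcoeff_szego subset_iff\<close>)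
    then show ?thesis by (simp add: 0 hcoeff_zero)
  qed
  have "(\<Sum>w\<in>W. u w * poly p (cnj w)) = (\<Sum>w\<in>W. \<Sum>i\<le>degree p. coeff p i * (u w * cnj w ^ i))"
    by (simp add: poly_altdef sum_distrib_left mult_ac)
  also have "\<dots> = (\<Sum>i\<le>degree p. coeff p i * (\<Sum>w\<in>W. u w * cnj w ^ i))"
    by (subst sum.swap) (simp add: sum_distrib_left)
  also have "\<dots> = 0" by (simp add: *)
  also have "(\<Sum>w\<in>W. u w * poly p (cnj w)) = (\<Sum>w\<in>{v}. u w * poly p (cnj w))"
    by (rule sum.mono_neutral_right) (use W \<open>v \<in> W\<close> in \<open>auto simp: p_def poly_prod prod_zero_iff\<close>)
  finally have "u v = 0 \<or> poly p (cnj v) = 0" by simp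
  moreover have "poly p (cnj v) \<noteq> 0"
    using W by (auto simp: p_def poly_prod prod_zero_iff)
  ultimately show ?thesis by simp
qed

lemma szego_inj_on: "inj_on szego (ball 0 1)"
proof (rule inj_onI)
  fix v w :: complex assume "v \<in> ball 0 1" "w \<in> ball 0 1" "szego v = szego w"
  then have "cnj v ^ 1 = cnj w ^ 1" by (metis hcoeff_szego mem_ball_0)
  then show "v = w" by simp
qed

lemma szego_independent:
  assumes W: "finite W" "W \<subseteq> ball 0 1" shows "hardy.independent (szego ` W)"
proof (rule hardy.independent_if_scalars_zero)
  fix f x assume 0: "(\<Sum>x\<in>szego ` W. hscale (f x) x) = 0" and "x \<in> szego ` W"
  then obtain v where v: "v \<in> W" "x = szego v" by blast
  have "inj_on szego W" using szego_inj_on W(2) inj_on_subset by blast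
  then have "(\<Sum>w\<in>W. hscale (f (szego w)) (szego w)) = 0"
    using 0 by (simp add: sum.reindex)
  from szego_combination_eq_0[OF W this v(1)] show "f x = 0" by (simp add: v(2))
qed (use W in simp)

lemma dim_span_szego:
  assumes W: "finite W" "W \<subseteq> ball 0 1" shows "hardy.dim (hardy.span (szego ` W)) = card W"
proof -
  have "inj_on szego W" using szego_inj_on W(2) inj_on_subset by blast
  then show ?thesis
    using hardy.dim_span_eq_card_independent[OF szego_independent[OF W]] by (simp add: card_image)
qed

section \<open>Products of Blaschke factors and kernels\<close>

text \<open>Unites the two cases of the definition. For \<open>a = 0\<close> the quotient is
  \<open>-z\<close>, whence \<open>u = -1\<close> there.\<close>

lemma blaschke_factor_unimodular:
  obtains u where "cmod u = 1" "\<And>z. blaschke_factor a z = u * ((a - z) / (1 - cnj a * z))"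
proof (cases "a = 0")
  case True
  then show ?thesis using that[of "-1"] by (simp add: blaschke_factor_def)
next
  case False
  then show ?thesis
    using that[of "cnj a / of_real (cmod a)"] by (simp add: blaschke_factor_def norm_divide)
qed

lemma blaschke_factor_eq_0_iff:
  assumes "cmod a < 1" "cmod z < 1" shows "blaschke_factor a z = 0 \<longleftrightarrow> z = a"
proof -
  obtain u where "cmod u = 1" "blaschke_factor a z = u * ((a - z) / (1 - cnj a * z))"
    using blaschke_factor_unimodular[of a] by metis
  then show ?thesis using szego_denominator_nonzero[OF assms] by auto
qed

lemma blaschke_eq_0_iff:
  assumes "finite A" "A \<subseteq> ball 0 1" "cmod z < 1" shows "blaschke A z = 0 \<longleftrightarrow> z \<in> A"
  using assms by (auto simp: blaschke_def prod_zero_iff blaschke_factor_eq_0_iff subset_iff)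

text \<open>The right side is the kernel at \<open>w\<close> minus its projection onto the line
  spanned by the kernel at \<open>a\<close>: the scalar is the inner product of the two kernels
  divided by the squared norm of \<open>szego a\<close>.\<close>

lemma blaschke_factor_times_szego:
  assumes a: "cmod a < 1" and w: "cmod w < 1" and z: "cmod z < 1"
  shows "blaschke_factor a z * cnj (blaschke_factor a w) * hardy_fun (szego w) z =
     hardy_fun (szego w - hscale ((1 - a * cnj a) / (1 - a * cnj w)) (szego a)) z"
proof -
  obtain u where u: "cmod u = 1" "\<And>z. blaschke_factor a z = u * ((a - z) / (1 - cnj a * z))"
    using blaschke_factor_unimodular[of a] by metis
  have uu: "u * cnj u = 1" using u(1) complex_norm_square[of u] by simp
  have n: "1 - cnj a * z \<noteq> 0" "1 - cnj w * z \<noteq> 0" "1 - a * cnj w \<noteq> 0"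
    using szego_denominator_nonzero a w z by (auto simp: mult.commute)
  have "blaschke_factor a z * cnj (blaschke_factor a w) =
      (u * cnj u) * (((a - z) / (1 - cnj a * z)) * ((cnj a - cnj w) / (1 - a * cnj w)))"
    by (simp add: u(2) mult_ac)
  also have "\<dots> * hardy_fun (szego w) z =
     1 / (1 - cnj w * z) - (1 - a * cnj a) / (1 - a * cnj w) * (1 / (1 - cnj a * z))"
    using n by (simp add: uu hardy_fun_szego w z divide_simps) (simp add: algebra_simps)
  finally show ?thesis
    by (simp add: hardy_fun_diff hardy_fun_hscale hardy_fun_szego a w z)
qed

text \<open>A partial fraction decomposition; \<open>v \<noteq> a\<close> keeps the two poles
  distinct.\<close>

lemma blaschke_factor_times_other_szego:
  assumes a: "cmod a < 1" and v: "cmod v < 1" and "v \<noteq> a"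
  obtains c d where "\<And>z. cmod z < 1 \<Longrightarrow> blaschke_factor a z * hardy_fun (szego v) z =
     hardy_fun (hscale c (szego a) + hscale d (szego v)) z"
proof -
  obtain u where u: "\<And>z. blaschke_factor a z = u * ((a - z) / (1 - cnj a * z))"
    using blaschke_factor_unimodular[of a] by metis
  \<comment> \<open>Found by comparing coefficients of \<open>z\<close> in
    \<open>a - z = c (1 - cnj v z) + (a - c) (1 - cnj a z)\<close>; the constant terms agree for any
    \<open>c\<close>.\<close>
  define c where "c = (1 - a * cnj a) / (cnj v - cnj a)"
  have nv: "cnj v - cnj a \<noteq> 0" using \<open>v \<noteq> a\<close> by simp
  have "blaschke_factor a z * hardy_fun (szego v) z =
     hardy_fun (hscale (u * c) (szego a) + hscale (u * (a - c)) (szego v)) z" if z: "cmod z < 1" for z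
  proof -
    have n: "1 - cnj a * z \<noteq> 0" "1 - cnj v * z \<noteq> 0"
      using szego_denominator_nonzero a v z by auto
    have c: "c * (cnj v - cnj a) = 1 - a * cnj a" using nv by (simp add: c_def)
    have "c * (1 - cnj v * z) + (a - c) * (1 - cnj a * z) = a - a * cnj a * z - z * (c * (cnj v - cnj a))"
      by (simp add: algebra_simps)
    also have "\<dots> = a - z" unfolding c by (simp add: algebra_simps)
    finally have "a - z = c * (1 - cnj v * z) + (a - c) * (1 - cnj a * z)" ..
    then have "(a - z) / (1 - cnj a * z) * (1 / (1 - cnj v * z)) =
        c * (1 / (1 - cnj a * z)) + (a - c) * (1 / (1 - cnj v * z))"
      using n by (simp add: divide_simps)
    then show ?thesis
      by (simp add: u hardy_fun_add hardy_fun_hscale hardy_fun_szego a v z ring_distribs mult.assoc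
          del: times_divide_eq_right times_divide_eq_left)
  qed
  then show ?thesis by (rule that)
qed

text \<open>Multiplying the kernel at \<open>w\<close> by \<open>B\<^sub>A\<close> and the conjugate
  of \<open>B\<^sub>A(w)\<close> changes it only by kernels at points of \<open>A\<close>. In the
  induction a further factor for \<open>a\<close> acts on the kernel at \<open>w\<close> by
  subtracting a multiple of \<open>szego a\<close>, and maps each kernel at a point of the old set,
  which differs from \<open>a\<close>, to a combination of itself and
  \<open>szego a\<close>.\<close>

lemma blaschke_kernel_in_span:
  assumes "finite A" "A \<subseteq> ball 0 1" and w: "cmod w < 1"
  shows "\<exists>s\<in>hardy.span (szego ` A). \<forall>z. cmod z < 1 \<longrightarrow>
     hardy_fun (szego w + s) z = blaschke A z * cnj (blaschke A w) * hardy_fun (szego w) z"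
  using assms(1,2)
proof (induction A)
  case empty
  show ?case by (simp add: blaschke_def)
next
  case (insert a A)
  then obtain s where s: "s \<in> hardy.span (szego ` A)"
    "\<And>z. cmod z < 1 \<Longrightarrow> hardy_fun (szego w + s) z = blaschke A z * cnj (blaschke A w) * hardy_fun (szego w) z"
    by auto
  have a: "cmod a < 1" using insert.prems by simp
  define K where "K = hardy.span (szego ` insert a A)"
  have aK: "szego a \<in> K" unfolding K_def by (intro hardy.span_base) simp
  define f where "f z = blaschke_factor a z * cnj (blaschke_factor a w)" for z
  \<comment> \<open>Multiplication by \<open>f\<close> maps the span of the kernels at the old
    points into \<open>K\<close>; it suffices to follow single kernels.\<close>
  have "\<exists>t\<in>K. \<forall>z. cmod z < 1 \<longrightarrow> hardy_fun t z = f z * hardy_fun s z"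
    using s(1)
  proof (induction rule: hardy.span_induct_alt)
    case base
    have "0 \<in> K" unfolding K_def by (rule hardy.span_zero)
    then show ?case by (intro bexI[of _ 0]) (auto simp: hardy_fun_zero)
  next
    case (step c x y)
    then obtain t where t: "t \<in> K" "\<And>z. cmod z < 1 \<Longrightarrow> hardy_fun t z = f z * hardy_fun y z" by auto
    obtain v where v: "v \<in> A" "x = szego v" using step by blast
    then have "cmod v < 1" "v \<noteq> a" using insert by auto
    then obtain p q where pq: "\<And>z. cmod z < 1 \<Longrightarrow> blaschke_factor a z * hardy_fun (szego v) z =
        hardy_fun (hscale p (szego a) + hscale q (szego v)) z"
      using blaschke_factor_times_other_szego[OF a, of v] by metis
    have vK: "szego v \<in> K" unfolding K_def by (intro hardy.span_base) (simp add: v)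
    define t' where "t' = hscale (c * cnj (blaschke_factor a w)) (hscale p (szego a) + hscale q (szego v)) + t"
    have "t' \<in> K"
      using aK vK t(1) unfolding t'_def K_def by (intro hardy.span_add hardy.span_scale)
    moreover have "hardy_fun t' z = f z * hardy_fun (hscale c x + y) z" if "cmod z < 1" for z
    proof -
      have "hardy_fun t' z = c * cnj (blaschke_factor a w) * (blaschke_factor a z * hardy_fun (szego v) z)
          + f z * hardy_fun y z"
        unfolding pq[OF that] by (simp add: t'_def hardy_fun_add hardy_fun_hscale t(2)[OF that])
      then show ?thesis by (simp add: hardy_fun_add hardy_fun_hscale f_def v(2) algebra_simps)
    qed
    ultimately show ?case by blast
  qed
  then obtain t where t: "t \<in> K" "\<And>z. cmod z < 1 \<Longrightarrow> hardy_fun t z = f z * hardy_fun s z" by blast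
  define d where "d = hscale ((1 - a * cnj a) / (1 - a * cnj w)) (szego a)"
  have "t - d \<in> K"
    using aK t(1) unfolding d_def K_def by (intro hardy.span_diff hardy.span_scale)
  moreover have "hardy_fun (szego w + (t - d)) z =
      blaschke (insert a A) z * cnj (blaschke (insert a A) w) * hardy_fun (szego w) z" if z: "cmod z < 1" for z
  proof -
    have "hardy_fun (szego w + (t - d)) z = f z * hardy_fun (szego w) z + f z * hardy_fun s z"
      using blaschke_factor_times_szego[OF a w z] t(2)[OF z]
      by (simp add: d_def f_def hardy_fun_add hardy_fun_diff)
    also have "\<dots> = f z * hardy_fun (szego w + s) z"
      by (simp add: hardy_fun_add algebra_simps)
    also have "\<dots> = blaschke (insert a A) z * cnj (blaschke (insert a A) w) * hardy_fun (szego w) z"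
      using insert.hyps by (simp add: s(2)[OF z] f_def blaschke_def)
    finally show ?thesis .
  qed
  ultimately show ?case unfolding K_def by blast
qed

section \<open>The spaces of functions vanishing on a set\<close>

lemma vanishing_space_commute: "vanishing_space A B C = vanishing_space B A C"
  by (simp add: vanishing_space_def kernel_space_def Un_commute)

lemma fin_dim_kernel_space:
  "finite A \<Longrightarrow> finite B \<Longrightarrow> fin_dim_subspace (kernel_space A B)"
  unfolding fin_dim_subspace_def kernel_space_def
  by (intro conjI exI[of _ "szego ` (A \<union> B)"]) auto

lemma fin_dim_vanishing_space:
  assumes "finite A" "finite B" shows "fin_dim_subspace (vanishing_space A B C)"
proof -
  have "hardy.subspace (vanishing_space A B C)"
    using fin_dim_kernel_space[OF assms]
    unfolding fin_dim_subspace_def vanishing_space_def hardy.subspace_def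
    by (auto simp: hardy_fun_add hardy_fun_hscale hardy_fun_zero)
  then show ?thesis
    using fin_dim_kernel_space[OF assms]
    unfolding fin_dim_subspace_def vanishing_space_def by blast
qed

text \<open>\<open>h\<close> is the projection of the kernel at \<open>w\<close> onto the functions vanishing on \<open>A\<close>, namely
  \<open>B\<^sub>A\<close> times the conjugate of \<open>B\<^sub>A(w)\<close> times the kernel.\<close>

lemma vanishing_kernel:
  assumes A: "finite A" "A \<subseteq> ball 0 1" and w: "w \<in> B" "cmod w < 1"
  obtains h where "h \<in> vanishing_space A B A"
    "hinner h (szego w) = of_real ((cmod (blaschke A w))\<^sup>2 * (norm (szego w))\<^sup>2)"
    "(norm h)\<^sup>2 = (cmod (blaschke A w))\<^sup>2 * (norm (szego w))\<^sup>2"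
proof -
  obtain s where s: "s \<in> hardy.span (szego ` A)"
    "\<And>z. cmod z < 1 \<Longrightarrow> hardy_fun (szego w + s) z = blaschke A z * cnj (blaschke A w) * hardy_fun (szego w) z"
    using blaschke_kernel_in_span[OF A w(2)] by blast
  define h where "h = szego w + s"
  have h0: "hardy_fun h a = 0" if "a \<in> A" for a
    using that A s(2)[of a] blaschke_eq_0_iff[OF A, of a] by (auto simp: h_def)
  have "s \<in> hardy.span (szego ` (A \<union> B))"
    using s(1) hardy.span_mono[of "szego ` A" "szego ` (A \<union> B)"] by blast
  moreover have "szego w \<in> hardy.span (szego ` (A \<union> B))"
    using w by (intro hardy.span_base) simp
  ultimately have "h \<in> kernel_space A B"
    unfolding h_def kernel_space_def by (rule hardy.span_add[rotated])
  then have 1: "h \<in> vanishing_space A B A" using h0 by (simp add: vanishing_space_def)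
  have "hinner h (szego w) = blaschke A w * cnj (blaschke A w) * hinner (szego w) (szego w)"
    using s(2)[OF w(2)] by (simp add: hinner_szego[OF w(2)] h_def)
  then have 2: "hinner h (szego w) = of_real ((cmod (blaschke A w))\<^sup>2 * (norm (szego w))\<^sup>2)"
    by (simp add: hinner_norm complex_norm_square[symmetric])
  \<comment> \<open>As \<open>h\<close> vanishes on \<open>A\<close>, it is orthogonal to the
    kernels there, so \<open>hinner h h\<close> reduces to
    \<open>hinner h (szego w)\<close>.\<close>
  have "hinner h s = 0"
  proof (rule hinner_span_eq_0[OF _ s(1)])
    fix e assume "e \<in> szego ` A"
    then show "hinner h e = 0" using h0 A by (auto simp: hinner_szego subset_iff)
  qed
  then have "hinner h h = of_real ((cmod (blaschke A w))\<^sup>2 * (norm (szego w))\<^sup>2)"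
    using 2 hinner_add_right[of h "szego w" s] by (simp add: h_def)
  then have "(norm h)\<^sup>2 = (cmod (blaschke A w))\<^sup>2 * (norm (szego w))\<^sup>2"
    unfolding hinner_norm by (metis of_real_eq_iff)
  with 1 2 show ?thesis by (rule that)
qed

section \<open>The angle inequality\<close>

text \<open>The vector \<open>d = h - m\<^sup>2 k\<close> has squared norm
  \<open>(1 - m\<^sup>2)\<close> times that of \<open>h\<close>, and
  \<open>hinner d g = hinner h g\<close> because \<open>g\<close> is orthogonal to \<open>k\<close>.
  Cauchy-Schwarz for \<open>d\<close> and \<open>g\<close> then compares \<open>C\<close> with the
  square root of \<open>1 - m\<^sup>2\<close>.\<close>

lemma angle_bound:
  assumes hk: "hinner h k = of_real (m\<^sup>2 * (norm k)\<^sup>2)" and hh: "(norm h)\<^sup>2 = m\<^sup>2 * (norm k)\<^sup>2"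
    and "h \<noteq> 0" and gk: "hinner g k = 0" and g0: "C \<noteq> 0 \<Longrightarrow> g \<noteq> 0" and "0 \<le> C"
    and C: "C * norm h * norm g \<le> cmod (hinner h g)"
  shows "C\<^sup>2 + m\<^sup>2 \<le> 1"
proof -
  define d where "d = h - hscale (of_real (m\<^sup>2)) k"
  have kg: "hinner k g = 0" using gk hinner_eq_0_commute by blast
  have kh: "hinner k h = of_real (m\<^sup>2 * (norm k)\<^sup>2)"
    using hk hinner_commute[of k h] by simp
  have "hinner d d = of_real ((norm h)\<^sup>2 * (1 - m\<^sup>2))"
    unfolding d_def hinner_diff_left hinner_diff_right hinner_hscale_left hinner_hscale_right
    unfolding hk kh hinner_norm hh by (simp add: algebra_simps power2_eq_square)
  then have dd: "(norm d)\<^sup>2 = (norm h)\<^sup>2 * (1 - m\<^sup>2)"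
    unfolding hinner_norm by (metis of_real_eq_iff)
  have h0: "(norm h)\<^sup>2 > 0" using \<open>h \<noteq> 0\<close> by simp
  show ?thesis
  proof (cases "C = 0")
    \<comment> \<open>Here \<open>g\<close> may vanish; what remains,
      \<open>m\<^sup>2 \<le> 1\<close>, follows from the squared norm of \<open>d\<close> being
      nonnegative.\<close>
    case True
    have "0 \<le> (norm h)\<^sup>2 * (1 - m\<^sup>2)" unfolding dd[symmetric] by simp
    then show ?thesis using h0 True by (simp add: zero_le_mult_iff)
  next
    case False
    then have ng: "norm g > 0" using g0 by simp
    have "hinner h g = hinner d g" by (simp add: d_def hinner_diff_left hinner_hscale_left kg)
    then have "C * norm h * norm g \<le> norm d * norm g"
      using C hinner_Cauchy_Schwarz[of d g] by simp
    then have "C * norm h \<le> norm d" using ng by simp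
    then have "(C * norm h)\<^sup>2 \<le> (norm d)\<^sup>2"
      using \<open>0 \<le> C\<close> by (intro power_mono) auto
    then have "C\<^sup>2 * (norm h)\<^sup>2 \<le> (1 - m\<^sup>2) * (norm h)\<^sup>2"
      by (simp add: dd power_mult_distrib mult.commute)
    then show ?thesis using h0 by simp
  qed
qed

text \<open>The common core of both estimates: \<open>C\<close> will be the least singular value in
  one and the cosine of the norm of \<open>X\<close> in the other. That \<open>w\<close> is not in
  \<open>A\<close> makes \<open>B\<^sub>A(w)\<close>, and with it the projected kernel
  \<open>h\<close>, nonzero.\<close>

lemma blaschke_bound:
  assumes A: "finite A" "A \<subseteq> ball 0 1" and B: "B \<subseteq> ball 0 1" and "w \<in> B" "w \<notin> A" and "0 \<le> C"
    and C: "\<And>h. h \<in> vanishing_space A B A \<Longrightarrow> h \<noteq> 0 \<Longrightarrow>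
      \<exists>g\<in>vanishing_space A B B. (C \<noteq> 0 \<longrightarrow> g \<noteq> 0) \<and> C * norm h * norm g \<le> cmod (hinner h g)"
  shows "C\<^sup>2 + (cmod (blaschke A w))\<^sup>2 \<le> 1"
proof -
  have w: "cmod w < 1" using \<open>w \<in> B\<close> B by auto
  obtain h where h: "h \<in> vanishing_space A B A"
    "hinner h (szego w) = of_real ((cmod (blaschke A w))\<^sup>2 * (norm (szego w))\<^sup>2)"
    "(norm h)\<^sup>2 = (cmod (blaschke A w))\<^sup>2 * (norm (szego w))\<^sup>2"
    using vanishing_kernel[OF A \<open>w \<in> B\<close> w] .
  have "hinner (szego w) (szego w) \<noteq> 0"
    using szego_denominator_nonzero[OF w w] by (simp add: hinner_szego[OF w] hardy_fun_szego w)
  then have "norm (szego w) \<noteq> 0" by simp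
  moreover have "blaschke A w \<noteq> 0" using blaschke_eq_0_iff[OF A w] \<open>w \<notin> A\<close> by simp
  ultimately have "h \<noteq> 0" using h(3) by auto
  from C[OF h(1) this] obtain g where g: "g \<in> vanishing_space A B B" "C \<noteq> 0 \<Longrightarrow> g \<noteq> 0"
    "C * norm h * norm g \<le> cmod (hinner h g)" by blast
  have "hinner g (szego w) = 0"
    using g(1) \<open>w \<in> B\<close> by (simp add: hinner_szego[OF w] vanishing_space_def)
  from angle_bound[OF h(2,3) \<open>h \<noteq> 0\<close> this g(2) \<open>0 \<le> C\<close> g(3)] show ?thesis by simp
qed

section \<open>The exponential of a self-adjoint operator\<close>

text \<open>Lets the scalar exponential series pass through \<open>hscale\<close> in the expansion
  of \<open>op_exp\<close>.\<close>

lemma bounded_linear_hscale_left: "bounded_linear (\<lambda>c. hscale c f)"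
  by (rule bounded_linear_intro[where K = "norm f"])
     (simp_all add: hardy.scale_left_distrib scaleR_hardy_def norm_hscale scaleR_conv_of_real)

text \<open>A unit eigenvector competes in the supremum. The supremum bounds its members only once
  the set is known to be bounded above, for which the crude bound by the sum of all
  \<open>\<bar>r e\<bar>\<close> suffices.\<close>

lemma self_adjoint_eigenvalue_bound:
  assumes X: "self_adjoint_on V X" and E: "orthonormal_basis V E"
    and r: "\<And>e. e \<in> E \<Longrightarrow> X e = hscale (of_real (r e)) e" and V: "fin_dim_subspace V" and "e \<in> E"
  shows "\<bar>r e\<bar> \<le> op_norm_on V X"
proof -
  have sV: "hardy.subspace V" and EV: "E \<subseteq> V" and oE: "orthonormal E"
    and X': "linear_operator_on V X"
    using V E X hardy.span_base by (auto simp: fin_dim_subspace_def orthonormal_basis_def self_adjoint_on_def)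
  have n1: "norm e = 1" if "e \<in> E" for e using orthonormal_norm[OF oE that] .
  have "norm (X f) \<le> (\<Sum>e\<in>E. \<bar>r e\<bar>)" if f: "f \<in> V" "norm f \<le> 1" for f
  proof -
    have "X f = X (\<Sum>e\<in>E. hscale (hinner f e) e)"
      using orthonormal_basis_expansion[OF E f(1)] by simp
    also have "\<dots> = (\<Sum>e\<in>E. hscale (hinner f e) (X e))"
      using linear_operator_on_sum[OF X' sV, of E "\<lambda>e. e" "hinner f"] EV by blast
    also have "norm \<dots> \<le> (\<Sum>e\<in>E. \<bar>r e\<bar>)"
    proof (rule sum_norm_le)
      fix e assume e: "e \<in> E"
      have "cmod (hinner f e) \<le> 1"
        using hinner_Cauchy_Schwarz[of f e] f(2) n1[OF e] by simp
      then show "norm (hscale (hinner f e) (X e)) \<le> \<bar>r e\<bar>"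
        using n1[OF e] mult_right_mono[of "cmod (hinner f e)" 1 "\<bar>r e\<bar>"]
        by (simp add: r[OF e] norm_hscale norm_mult)
    qed
    finally show ?thesis .
  qed
  then have "bdd_above ((\<lambda>f. norm (X f)) ` {f \<in> V. norm f \<le> 1})"
    by (intro bdd_aboveI2) auto
  then have "norm (X e) \<le> op_norm_on V X"
    unfolding op_norm_on_def
    by (rule cSUP_upper2[where x = e]) (use \<open>e \<in> E\<close> EV n1 in auto)
  then show ?thesis using \<open>e \<in> E\<close> by (simp add: r norm_hscale n1)
qed

text \<open>The \<open>k\<close>-th power of \<open>Y\<close> multiplies each coefficient by
  \<open>z e ^ k\<close>; the finite sum over \<open>E\<close> then exchanges with the exponential
  series.\<close>

lemma op_exp_eigenexpansion:
  assumes Y: "linear_operator_on V Y" and E: "orthonormal_basis V E"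
    and z: "\<And>e. e \<in> E \<Longrightarrow> Y e = hscale (z e) e" and V: "fin_dim_subspace V" and f: "f \<in> V"
  shows "op_exp Y f = (\<Sum>e\<in>E. hscale (hinner f e * exp (z e)) e)"
proof -
  have sV: "hardy.subspace V" and EV: "E \<subseteq> V"
    using V E hardy.span_base by (auto simp: fin_dim_subspace_def orthonormal_basis_def)
  have pow: "(Y ^^ k) f = (\<Sum>e\<in>E. hscale (hinner f e * z e ^ k) e)" for k
  proof (induction k)
    case 0
    show ?case using orthonormal_basis_expansion[OF E f] by simp
  next
    case (Suc k)
    have "(Y ^^ Suc k) f = Y (\<Sum>e\<in>E. hscale (hinner f e * z e ^ k) e)"
      using Suc by simp
    also have "\<dots> = (\<Sum>e\<in>E. hscale (hinner f e * z e ^ k) (Y e))"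
      using linear_operator_on_sum[OF Y sV, of E "\<lambda>e. e" "\<lambda>e. hinner f e * z e ^ k"] EV by blast
    also have "\<dots> = (\<Sum>e\<in>E. hscale (hinner f e * z e ^ Suc k) e)"
      by (rule sum.cong) (simp_all add: z mult_ac)
    finally show ?case .
  qed
  have eq: "(\<lambda>k. (Y ^^ k) f /\<^sub>R fact k) = (\<lambda>k. \<Sum>e\<in>E. hscale (hinner f e * (z e ^ k /\<^sub>R fact k)) e)"
    unfolding pow scaleR_sum_right
    by (simp add: scaleR_hardy_def scaleR_conv_of_real mult_ac)
  have "(\<lambda>k. \<Sum>e\<in>E. hscale (hinner f e * (z e ^ k /\<^sub>R fact k)) e) sums
      (\<Sum>e\<in>E. hscale (hinner f e * exp (z e)) e)"
    by (rule sums_sum) (rule bounded_linear.sums[OF bounded_linear_hscale_left sums_mult[OF exp_converges]])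
  from sums_unique[OF this] show ?thesis unfolding op_exp_def eq by (rule sym)
qed

text \<open>In an eigenbasis the exponential multiplies coefficients by unimodular numbers, which
  preserves the norm. The real part of \<open>hinner f g\<close> is the sum of the
  \<open>cos (r e)\<close> weighted by the squared coefficients of \<open>f\<close>, and each
  \<open>cos (r e)\<close> is at least the cosine of the norm of \<open>X\<close>, since cosine
  decreases on \<open>[0, pi]\<close>.\<close>

lemma op_exp_angle:
  assumes X: "self_adjoint_on V X" and V: "fin_dim_subspace V" and le: "op_norm_on V X \<le> pi / 2"
    and f: "f \<in> V"
  defines "g \<equiv> op_exp (\<lambda>f. hscale \<i> (X f)) f"
  shows "norm g = norm f \<and> cos (op_norm_on V X) * (norm f)\<^sup>2 \<le> cmod (hinner f g)"
proof -
  obtain E r where E: "orthonormal_basis V E" and r: "\<And>e. e \<in> E \<Longrightarrow> X e = hscale (of_real (r e)) e"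
    using spectral_theorem[OF V X] by metis
  then have fE: "finite E" "orthonormal E" by (auto simp: orthonormal_basis_def)
  have "linear_operator_on V (\<lambda>f. hscale \<i> (X f))"
    using X V unfolding self_adjoint_on_def linear_operator_on_def fin_dim_subspace_def
    by (auto simp: hardy.scale_right_distrib mult.commute intro!: hardy.subspace_scale)
  then have g: "g = (\<Sum>e\<in>E. hscale (hinner f e * exp (\<i> * r e)) e)"
    unfolding g_def by (rule op_exp_eigenexpansion[OF _ E _ V f]) (simp add: r)
  note f_eq = orthonormal_basis_expansion[OF E f]
  define u where "u = hinner f"
  have fu: "f = (\<Sum>e\<in>E. hscale (u e) e)" using f_eq by (simp add: u_def)
  have gu: "g = (\<Sum>e\<in>E. hscale (u e * exp (\<i> * r e)) e)" unfolding u_def by (rule g)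
  have nf: "(norm f)\<^sup>2 = (\<Sum>e\<in>E. (cmod (u e))\<^sup>2)"
    by (subst fu) (rule norm_orthonormal_sum[OF fE])
  have "(norm g)\<^sup>2 = (\<Sum>e\<in>E. (cmod (u e))\<^sup>2)"
    unfolding gu norm_orthonormal_sum[OF fE] by (simp add: norm_mult)
  then have "norm g = norm f" using nf by (simp add: power2_eq_imp_eq)
  moreover have "cos (op_norm_on V X) * (norm f)\<^sup>2 \<le> cmod (hinner f g)"
  proof -
    have "hinner f g = (\<Sum>e\<in>E. u e * cnj (u e * exp (\<i> * r e)))"
      using hinner_orthonormal_sums[OF fE, of u "\<lambda>e. u e * exp (\<i> * r e)"]
      unfolding fu[symmetric] gu[symmetric] .
    also have "\<dots> = (\<Sum>e\<in>E. of_real ((cmod (u e))\<^sup>2) * cis (- r e))"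
      by (rule sum.cong) (simp_all only: complex_cnj_mult cis_conv_exp[symmetric] cis_cnj complex_norm_square mult.assoc)
    finally have "Re (hinner f g) = (\<Sum>e\<in>E. cos (r e) * (cmod (u e))\<^sup>2)"
      by (simp add: mult.commute del: of_real_power)
    moreover have "cos (op_norm_on V X) \<le> cos (r e)" if "e \<in> E" for e
    proof -
      have "\<bar>r e\<bar> \<le> op_norm_on V X" using self_adjoint_eigenvalue_bound[OF X E r V that] .
      then have "cos (op_norm_on V X) \<le> cos \<bar>r e\<bar>"
        using le pi_gt_zero by (intro cos_monotone_0_pi_le) linarith+
      then show ?thesis by simp
    qed
    then have "cos (op_norm_on V X) * (norm f)\<^sup>2 \<le> (\<Sum>e\<in>E. cos (r e) * (cmod (u e))\<^sup>2)"
      unfolding nf sum_distrib_left by (intro sum_mono mult_right_mono) auto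
    ultimately show ?thesis using complex_Re_le_cmod[of "hinner f g"] by linarith
  qed
  ultimately show ?thesis ..
qed

lemma op_norm_on_nonneg:
  assumes X: "self_adjoint_on V X" and V: "fin_dim_subspace V"
  shows "0 \<le> op_norm_on V X"
proof (cases "V = {0}")
  case True
  then have "{f \<in> V. norm f \<le> 1} = {0}" by auto
  then show ?thesis by (simp add: op_norm_on_def)
next
  case False
  obtain E r where E: "orthonormal_basis V E" and r: "\<And>e. e \<in> E \<Longrightarrow> X e = hscale (of_real (r e)) e"
    using spectral_theorem[OF V X] by metis
  have "E \<noteq> {}" using E False by (auto simp: orthonormal_basis_def)
  then obtain e where "e \<in> E" by blast
  from self_adjoint_eigenvalue_bound[OF X E r V this] show ?thesis by linarith
qed

section \<open>The least singular value\<close>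

text \<open>Orthonormal bases of \<open>K\<close> and of its complement are disjoint and together
  form one of \<open>V\<close>, by the decomposition of \<open>f\<close> into
  \<open>f - proj K f\<close> and \<open>proj K f\<close>.\<close>

lemma dim_ortho_compl_in:
  assumes V: "fin_dim_subspace V" and K: "hardy.subspace K" "K \<subseteq> V"
  shows "hardy.dim (ortho_compl_in V K) + hardy.dim K = hardy.dim V"
proof -
  let ?L = "ortho_compl_in V K"
  have sV: "hardy.subspace V" using V by (simp add: fin_dim_subspace_def)
  have fK: "fin_dim_subspace K" using V K unfolding fin_dim_subspace_def by blast
  have "hardy.subspace ?L"
    using sV unfolding ortho_compl_in_def hardy.subspace_def
    by (auto simp: hinner_add_left hinner_hscale_left)
  then have fL: "fin_dim_subspace ?L"
    using V unfolding fin_dim_subspace_def ortho_compl_in_def by blast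
  obtain E where E: "orthonormal_basis K E" using orthonormal_basis_exists[OF fK] .
  obtain F where F: "orthonormal_basis ?L F" using orthonormal_basis_exists[OF fL] .
  have EK: "E \<subseteq> K" and FL: "F \<subseteq> ?L"
    using E F hardy.span_base by (auto simp: orthonormal_basis_def)
  have orth: "hinner f e = 0" "hinner e f = 0" if "e \<in> E" "f \<in> F" for e f
  proof -
    show "hinner f e = 0" using that EK FL by (auto simp: ortho_compl_in_def)
    then show "hinner e f = 0" using hinner_eq_0_commute by blast
  qed
  have nz: "hinner e e = 1" if "e \<in> E \<union> F" for e
    using that E F by (auto simp: orthonormal_basis_def orthonormal_def)
  have disj: "E \<inter> F = {}" using orth nz by fastforce
  have "orthonormal (E \<union> F)"
    unfolding orthonormal_def
  proof (intro ballI)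
    fix x y assume xy: "x \<in> E \<union> F" "y \<in> E \<union> F"
    show "hinner x y = (if x = y then 1 else 0)"
    proof (cases "x = y")
      case False
      then have "hinner x y = 0" if "x \<in> G" "y \<in> G" "orthonormal G" for G
        using that by (auto simp: orthonormal_def)
      then have "hinner x y = 0"
        using xy orth E F unfolding orthonormal_basis_def by blast
      then show ?thesis using False by simp
    qed (use nz xy in simp)
  qed
  moreover have "hardy.span (E \<union> F) = V"
  proof
    show "hardy.span (E \<union> F) \<subseteq> V"
      using EK FL K(2) sV by (intro hardy.span_minimal) (auto simp: ortho_compl_in_def)
    show "V \<subseteq> hardy.span (E \<union> F)"
    proof
      fix f assume f: "f \<in> V"
      have "f - proj K f \<in> ?L"
        using f proj_in[OF fK, of f] K(2) proj_residual[OF fK] hardy.subspace_diff[OF sV]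
        by (auto simp: ortho_compl_in_def)
      then have "f - proj K f \<in> hardy.span (E \<union> F)"
        using F hardy.span_mono[of F "E \<union> F"] by (auto simp: orthonormal_basis_def)
      moreover have "proj K f \<in> hardy.span (E \<union> F)"
        using E proj_in[OF fK, of f] hardy.span_mono[of E "E \<union> F"] by (auto simp: orthonormal_basis_def)
      ultimately have "(f - proj K f) + proj K f \<in> hardy.span (E \<union> F)" by (rule hardy.span_add)
      then show "f \<in> hardy.span (E \<union> F)" by simp
    qed
  qed
  ultimately have "orthonormal_basis V (E \<union> F)"
    using E F by (simp add: orthonormal_basis_def)
  moreover have "card (E \<union> F) = card E + card F"
    using E F disj by (intro card_Un_disjoint) (auto simp: orthonormal_basis_def)
  ultimately show ?thesis
    using E F by (simp add: orthonormal_basis_dim)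
qed

text \<open>By the reproducing property, vanishing on \<open>B\<close> means orthogonality to the
  kernels at \<open>B\<close>. All kernels at \<open>A \<union> B\<close> are independent, so the
  complement has dimension \<open>card (A \<union> B) - card B\<close>.\<close>

lemma dim_vanishing_space:
  assumes A: "finite A" "A \<subseteq> ball 0 1" and B: "finite B" "B \<subseteq> ball 0 1" and "A \<inter> B = {}"
  shows "hardy.dim (vanishing_space A B B) = card A"
proof -
  let ?K = "hardy.span (szego ` B)"
  have "vanishing_space A B B = ortho_compl_in (kernel_space A B) ?K"
  proof -
    have "(\<forall>c\<in>B. hardy_fun f c = 0) \<longleftrightarrow> (\<forall>g\<in>?K. hinner f g = 0)" for f
    proof
      assume *: "\<forall>c\<in>B. hardy_fun f c = 0"
      have "hinner f e = 0" if "e \<in> szego ` B" for e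
        using that * B by (auto simp: hinner_szego subset_iff)
      then show "\<forall>g\<in>?K. hinner f g = 0" by (blast intro: hinner_span_eq_0)
    next
      assume *: "\<forall>g\<in>?K. hinner f g = 0"
      show "\<forall>c\<in>B. hardy_fun f c = 0"
      proof
        fix c assume c: "c \<in> B"
        then have "hinner f (szego c) = 0" using * hardy.span_base[of "szego c" "szego ` B"] by blast
        then show "hardy_fun f c = 0" using c B by (auto simp: hinner_szego subset_iff)
      qed
    qed
    then show ?thesis by (simp add: vanishing_space_def ortho_compl_in_def)
  qed
  moreover have "?K \<subseteq> kernel_space A B"
    unfolding kernel_space_def by (rule hardy.span_mono) auto
  ultimately have "hardy.dim (vanishing_space A B B) + hardy.dim ?K = hardy.dim (kernel_space A B)"
    using dim_ortho_compl_in[OF fin_dim_kernel_space[OF A(1) B(1)], of ?K] by simp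
  moreover have "hardy.dim (kernel_space A B) = card (A \<union> B)"
    unfolding kernel_space_def using A B by (intro dim_span_szego) auto
  ultimately show ?thesis
    using dim_span_szego[OF B] assms by (simp add: card_Un_disjoint)
qed

text \<open>By self-adjointness an eigenvector for \<open>t\<close> is orthogonal to every basis
  vector with another eigenvalue, so its expansion uses only the basis vectors with
  \<open>r e = t\<close>.\<close>

lemma dim_eigenspace:
  assumes V: "fin_dim_subspace V" and D: "self_adjoint_on V D" and E: "orthonormal_basis V E"
    and r: "\<And>e. e \<in> E \<Longrightarrow> D e = hscale (of_real (r e)) e"
  shows "hardy.dim {f \<in> V. D f = hscale (of_real t) f} = card {e \<in> E. r e = t}"
proof -
  have sV: "hardy.subspace V" and EV: "E \<subseteq> V" and oE: "orthonormal E" "finite E"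
    using V E hardy.span_base by (auto simp: fin_dim_subspace_def orthonormal_basis_def)
  let ?E = "{e \<in> E. r e = t}" and ?W = "{f \<in> V. D f = hscale (of_real t) f}"
  have oE': "orthonormal ?E" using oE by (auto simp: orthonormal_def)
  have "?W \<subseteq> hardy.span ?E"
  proof
    fix f assume f: "f \<in> ?W"
    have 0: "hinner f e = 0" if e: "e \<in> E" "r e \<noteq> t" for e
    proof -
      have "hinner (D f) e = hinner f (D e)"
        using f e EV D unfolding self_adjoint_on_def by blast
      then have "of_real t * hinner f e = of_real (r e) * hinner f e"
        using f e by (simp add: r hinner_hscale_left hinner_hscale_right)
      then show ?thesis using e by simp
    qed
    have "f = (\<Sum>e\<in>E. hscale (hinner f e) e)"
      using orthonormal_basis_expansion[OF E] f by blast
    also have "\<dots> = (\<Sum>e\<in>?E. hscale (hinner f e) e)"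
      by (rule sum.mono_neutral_right) (use oE 0 in auto)
    also have "\<dots> \<in> hardy.span ?E" by (rule orthonormal_sum_in_span)
    finally show "f \<in> hardy.span ?E" .
  qed
  moreover have "?E \<subseteq> ?W" using EV r by auto
  ultimately show ?thesis
    using orthonormal_independent[OF oE'] by (intro hardy.dim_unique[of ?E]) auto
qed

text \<open>Gives the uniqueness required by the definite description in
  \<open>singular_values\<close>.\<close>

lemma sorted_wrt_ge_eqI:
  fixes xs ys :: "'a::linorder list"
  assumes "sorted_wrt (\<ge>) xs" "sorted_wrt (\<ge>) ys" "\<And>s. count_list xs s = count_list ys s"
  shows "xs = ys"
proof -
  have "mset (rev xs) = mset (rev ys)"
    using assms(3) by (intro multiset_eqI) (simp add: count_mset)
  moreover have "sorted (rev xs)" "sorted (rev ys)"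
    using assms by (simp_all add: sorted_wrt_rev)
  ultimately have "rev xs = rev ys"
    by (metis properties_for_sort)
  then show ?thesis by simp
qed

lemma singular_values_of_eigenbasis:
  assumes S: "fin_dim_subspace S" and D: "self_adjoint_on S (\<lambda>f. adjoint_from S T (T f))"
    and E: "orthonormal_basis S E"
    and r: "\<And>e. e \<in> E \<Longrightarrow> adjoint_from S T (T e) = hscale (of_real (r e)) e"
    and r0: "\<And>e. e \<in> E \<Longrightarrow> 0 \<le> r e" and es: "distinct es" "set es = E"
  shows "singular_values S T = rev (sort (map (\<lambda>e. sqrt (r e)) es))"
proof -
  let ?xs = "rev (sort (map (\<lambda>e. sqrt (r e)) es))"
  let ?P = "\<lambda>xs. sorted_wrt (\<ge>) xs \<and> (\<forall>s. count_list xs s =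
        (if 0 \<le> s then hardy.dim {f \<in> S. adjoint_from S T (T f) = hscale (of_real (s\<^sup>2)) f} else 0))"
  have cnt: "count_list ?xs s = card {e \<in> E. sqrt (r e) = s}" for s
  proof -
    have "count_list ?xs s = count (mset (map (\<lambda>e. sqrt (r e)) es)) s"
      by (simp add: count_mset[symmetric])
    also have "\<dots> = length (filter (\<lambda>e. sqrt (r e) = s) es)"
      by (induction es) auto
    also have "\<dots> = card {e \<in> E. sqrt (r e) = s}"
      using es by (simp add: distinct_length_filter Collect_conj_eq Int_commute)
    finally show ?thesis .
  qed
  have "?P ?xs"
  proof (intro conjI allI)
    show "sorted_wrt (\<ge>) ?xs" by (simp add: sorted_wrt_rev)
    fix s :: real
    show "count_list ?xs s =
        (if 0 \<le> s then hardy.dim {f \<in> S. adjoint_from S T (T f) = hscale (of_real (s\<^sup>2)) f} else 0)"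
    proof (cases "0 \<le> s")
      case True
      have "{e \<in> E. sqrt (r e) = s} = {e \<in> E. r e = s\<^sup>2}"
        using r0 True by (auto simp: real_sqrt_unique)
      then show ?thesis
        unfolding cnt using True dim_eigenspace[OF S D E r, of "s\<^sup>2"] by simp
    next
      case False
      have "{e \<in> E. sqrt (r e) = s} = {}" using r0 False by auto
      then have "card {e \<in> E. sqrt (r e) = s} = 0" by (simp only: card.empty)
      then show ?thesis unfolding cnt using False by simp
    qed
  qed
  moreover have "xs = ?xs" if "?P xs" for xs
    by (rule sorted_wrt_ge_eqI) (use that \<open>?P ?xs\<close> in auto)
  ultimately show ?thesis unfolding singular_values_def by (rule the_equality)
qed

text \<open>The last entry \<open>c\<close> of the decreasing list is the smallest
  \<open>sqrt (r e)\<close>. In the eigenbasis the squared norm of \<open>T f\<close> is the sum of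
  the squared coefficients of \<open>f\<close> weighted by \<open>r e\<close>, and
  \<open>r e \<ge> c\<^sup>2\<close> throughout.\<close>

lemma singular_value_least:
  assumes S: "fin_dim_subspace S" and dim: "hardy.dim S = n" "n \<ge> 1"
    and D: "self_adjoint_on S (\<lambda>f. adjoint_from S T (T f))"
    and T: "\<And>f. f \<in> S \<Longrightarrow> hinner (adjoint_from S T (T f)) f = of_real ((norm (T f))\<^sup>2)"
  shows "0 \<le> singular_value S T (n - 1)"
    and "f \<in> S \<Longrightarrow> singular_value S T (n - 1) * norm f \<le> norm (T f)"
proof -
  let ?c = "singular_value S T (n - 1)"
  obtain E r where E: "orthonormal_basis S E"
    and r: "\<And>e. e \<in> E \<Longrightarrow> adjoint_from S T (T e) = hscale (of_real (r e)) e"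
    using spectral_theorem[OF S D] by metis
  then have fE: "finite E" "orthonormal E" and ES: "E \<subseteq> S"
    using hardy.span_base by (auto simp: orthonormal_basis_def)
  have sS: "hardy.subspace S" using S by (simp add: fin_dim_subspace_def)
  have "r e = (norm (T e))\<^sup>2" if "e \<in> E" for e
  proof -
    have "complex_of_real (r e) = hinner (adjoint_from S T (T e)) e"
      using fE that by (simp add: r hinner_hscale_left hinner_norm orthonormal_norm)
    also have "\<dots> = of_real ((norm (T e))\<^sup>2)" using T that ES by blast
    finally show ?thesis by (metis of_real_eq_iff)
  qed
  then have r0: "0 \<le> r e" if "e \<in> E" for e using that by simp
  obtain es where es: "set es = E" "distinct es" using finite_distinct_list[OF fE(1)] by blast
  define xs where "xs = rev (sort (map (\<lambda>e. sqrt (r e)) es))"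
  have sv: "singular_values S T = xs"
    unfolding xs_def by (rule singular_values_of_eigenbasis[OF S D E r r0 es(2,1)])
  \<comment> \<open>This makes \<open>n - 1\<close> the index of the last entry.\<close>
  have len: "length xs = n"
    using dim es orthonormal_basis_dim[OF E] distinct_card[of es] by (simp add: xs_def)
  have set: "set xs = (\<lambda>e. sqrt (r e)) ` E" by (simp add: xs_def es)
  have c: "?c = xs ! (n - 1)" by (simp add: singular_value_def sv)
  then have "?c \<in> set xs" using len dim by simp
  then show c0: "0 \<le> ?c" using set r0 by auto
  have "?c \<le> x" if x: "x \<in> set xs" for x
  proof -
    obtain i where i: "i < n" "x = xs ! i" using x len in_set_conv_nth[of x xs] by blast
    have "sorted_wrt (\<ge>) xs" by (simp add: xs_def sorted_wrt_rev)
    then show ?thesis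
      using i len c by (cases "i = n - 1") (auto simp: sorted_wrt_iff_nth_less)
  qed
  then have "?c \<le> sqrt (r e)" if "e \<in> E" for e using set that by auto
  then have cr: "?c\<^sup>2 \<le> r e" if "e \<in> E" for e
    using that c0 r0 power_mono[of ?c "sqrt (r e)" 2] by simp
  show "?c * norm f \<le> norm (T f)" if f: "f \<in> S"
  proof -
    define u where "u = hinner f"
    have fu: "f = (\<Sum>e\<in>E. hscale (u e) e)"
      using orthonormal_basis_expansion[OF E f] by (simp add: u_def)
    have nf: "(norm f)\<^sup>2 = (\<Sum>e\<in>E. (cmod (u e))\<^sup>2)"
      by (subst fu) (rule norm_orthonormal_sum[OF fE])
    have "linear_operator_on S (\<lambda>f. adjoint_from S T (T f))"
      using D by (simp add: self_adjoint_on_def)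
    from linear_operator_on_sum[OF this sS, of E "\<lambda>e. e" u] ES
    have "adjoint_from S T (T f) = (\<Sum>e\<in>E. hscale (u e) (adjoint_from S T (T e)))"
      using fu by auto
    also have "\<dots> = (\<Sum>e\<in>E. hscale (u e * of_real (r e)) e)"
      by (rule sum.cong) (simp_all add: r)
    finally have "hinner (adjoint_from S T (T f)) f = (\<Sum>e\<in>E. u e * of_real (r e) * cnj (u e))"
      using hinner_orthonormal_sums[OF fE, of "\<lambda>e. u e * of_real (r e)" u] fu by simp
    also have "\<dots> = of_real (\<Sum>e\<in>E. r e * (cmod (u e))\<^sup>2)"
      unfolding of_real_sum of_real_mult complex_norm_square
      by (rule sum.cong) (simp_all only: mult_ac)
    finally have "(norm (T f))\<^sup>2 = (\<Sum>e\<in>E. r e * (cmod (u e))\<^sup>2)"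
      unfolding T[OF f] by (metis of_real_eq_iff)
    moreover have "(?c * norm f)\<^sup>2 \<le> (\<Sum>e\<in>E. r e * (cmod (u e))\<^sup>2)"
      unfolding power_mult_distrib nf sum_distrib_left
      using cr by (intro sum_mono mult_right_mono) auto
    ultimately show ?thesis by (metis norm_ge_zero power2_le_imp_le)
  qed
qed

text \<open>On \<open>S\<close> the inner projection is the identity, and both projections can be
  moved across the inner product. A second candidate differs from this one by an element of
  \<open>S\<close> orthogonal to itself.\<close>

lemma adjoint_from_projections:
  assumes S: "fin_dim_subspace S" and S': "fin_dim_subspace S'"
  shows "adjoint_from S (proj S' \<circ> proj S) g = proj S (proj S' g)"
  unfolding adjoint_from_def
proof (rule the_equality)
  have *: "hinner ((proj S' \<circ> proj S) f) g = hinner f (proj S (proj S' g))" if "f \<in> S" for f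
  proof -
    have "hinner ((proj S' \<circ> proj S) f) g = hinner (proj S' f) g"
      using that by (simp add: proj_fixes[OF S])
    also have "\<dots> = hinner (proj S' f) (proj S' g)"
      using hinner_proj_right[OF S' proj_in[OF S']] by simp
    also have "\<dots> = hinner f (proj S' g)"
      using hinner_proj_left[OF S' proj_in[OF S']] .
    also have "\<dots> = hinner f (proj S (proj S' g))"
      using hinner_proj_right[OF S that] by simp
    finally show ?thesis .
  qed
  then show "proj S (proj S' g) \<in> S \<and>
      (\<forall>f\<in>S. hinner ((proj S' \<circ> proj S) f) g = hinner f (proj S (proj S' g)))"
    using proj_in[OF S] by blast
  fix h assume h: "h \<in> S \<and> (\<forall>f\<in>S. hinner ((proj S' \<circ> proj S) f) g = hinner f h)"
  let ?d = "h - proj S (proj S' g)"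
  have "?d \<in> S"
    using h proj_in[OF S] S by (auto simp: fin_dim_subspace_def intro: hardy.subspace_diff)
  then have "hinner ?d h = hinner ?d (proj S (proj S' g))" using h * by metis
  then have "hinner ?d ?d = 0" by (simp add: hinner_diff_right)
  then show "h = proj S (proj S' g)" by simp
qed

lemma least_singular_value_projections:
  fixes S S' :: "hardy set" and n :: nat
  assumes S: "fin_dim_subspace S" and S': "fin_dim_subspace S'" and dim: "hardy.dim S = n" "n \<ge> 1"
  defines "c \<equiv> singular_value S (proj S' \<circ> proj S) (n - 1)"
  shows "0 \<le> c" and "f \<in> S \<Longrightarrow> c * norm f \<le> norm (proj S' f)"
proof -
  let ?T = "proj S' \<circ> proj S"
  have D: "adjoint_from S ?T (?T f) = proj S (proj S' f)" if "f \<in> S" for f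
    unfolding adjoint_from_projections[OF S S']
    using that by (simp add: proj_fixes[OF S] proj_fixes[OF S' proj_in[OF S']])
  have sa: "hinner (proj S (proj S' f)) g = hinner (proj S' f) (proj S' g)" if "g \<in> S" for f g
    using that by (simp add: hinner_proj_left[OF S] hinner_proj_right[OF S' proj_in[OF S']])
  have sa': "hinner f (proj S (proj S' g)) = hinner (proj S' f) (proj S' g)" if "f \<in> S" for f g
    using that by (simp add: hinner_proj_right[OF S] hinner_proj_left[OF S' proj_in[OF S']])
  have sS: "hardy.subspace S" using S by (simp add: fin_dim_subspace_def)
  have "self_adjoint_on S (\<lambda>f. adjoint_from S ?T (?T f))"
    unfolding self_adjoint_on_def linear_operator_on_def
    using hardy.subspace_add[OF sS] hardy.subspace_scale[OF sS] proj_in[OF S]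
    by (auto simp: D proj_add[OF S] proj_add[OF S'] proj_hscale[OF S] proj_hscale[OF S'] sa sa' simp del: o_apply)
  moreover have "hinner (adjoint_from S ?T (?T f)) f = of_real ((norm (?T f))\<^sup>2)" if "f \<in> S" for f
    using that unfolding D[OF that] sa[OF that] hinner_norm by (simp add: proj_fixes[OF S])
  ultimately have *: "0 \<le> c" "f \<in> S \<Longrightarrow> c * norm f \<le> norm (?T f)" for f
    unfolding c_def using singular_value_least[OF S dim] by blast+
  show "0 \<le> c" by (rule *)
  show "f \<in> S \<Longrightarrow> c * norm f \<le> norm (proj S' f)"
    using *(2)[of f] by (simp add: proj_fixes[OF S])
qed

text \<open>An injective linear map between spaces of equal finite dimension is onto: the images of
  a basis of \<open>S\<close> are independent, and an \<open>h\<close> outside their span would give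
  one independent vector too many in \<open>S'\<close>.\<close>

lemma proj_surj:
  assumes S: "fin_dim_subspace S" and S': "fin_dim_subspace S'"
    and dim: "hardy.dim S = hardy.dim S'"
    and inj: "\<And>f. f \<in> S \<Longrightarrow> proj S' f = 0 \<Longrightarrow> f = 0" and "h \<in> S'"
  shows "\<exists>f\<in>S. proj S' f = h"
proof -
  obtain E where E: "orthonormal_basis S E" using orthonormal_basis_exists[OF S] .
  obtain F where F: "orthonormal_basis S' F" using orthonormal_basis_exists[OF S'] .
  have fE: "finite E" "orthonormal E" and ES: "E \<subseteq> S" and sS: "hardy.subspace S"
    and fF: "finite F" and FS: "hardy.span F = S'"
    using E F S hardy.span_base by (auto simp: orthonormal_basis_def fin_dim_subspace_def)
  have cards: "card E = card F"
    using dim E F by (simp add: orthonormal_basis_dim)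
  have lin: "proj S' (\<Sum>e\<in>I. hscale (u e) e) = (\<Sum>e\<in>I. hscale (u e) (proj S' e))" for I u
  proof (induction I rule: infinite_finite_induct)
    have "proj S' 0 = 0" using proj_hscale[OF S', of 0 0] by simp
    { case (infinite I) with \<open>proj S' 0 = 0\<close> show ?case by simp }
    { case empty with \<open>proj S' 0 = 0\<close> show ?case by simp }
  qed (simp add: proj_add[OF S'] proj_hscale[OF S'])
  have injE: "inj_on (proj S') E"
  proof (rule inj_onI)
    fix x y assume xy: "x \<in> E" "y \<in> E" "proj S' x = proj S' y"
    have "proj S' (x + hscale (-1) y) = 0"
      unfolding proj_add[OF S'] proj_hscale[OF S'] using xy by simp
    then have "proj S' (x - y) = 0" by simp
    moreover have "x - y \<in> S" using xy ES sS by (auto intro: hardy.subspace_diff)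
    ultimately show "x = y" using inj by fastforce
  qed
  have ind: "hardy.independent (proj S' ` E)"
  proof (rule hardy.independent_if_scalars_zero)
    fix u x assume 0: "(\<Sum>x\<in>proj S' ` E. hscale (u x) x) = 0" and "x \<in> proj S' ` E"
    then obtain e where e: "e \<in> E" "x = proj S' e" by blast
    let ?f = "\<Sum>e\<in>E. hscale (u (proj S' e)) e"
    have "proj S' ?f = 0" using 0 by (simp add: lin sum.reindex[OF injE])
    moreover have "?f \<in> S"
      using E orthonormal_sum_in_span[of "\<lambda>e. u (proj S' e)" E] by (simp add: orthonormal_basis_def)
    ultimately have "?f = 0" using inj by blast
    then show "u x = 0"
      using hinner_orthonormal_sum[OF fE e(1), of "\<lambda>e. u (proj S' e)"] e(2) by simp
  qed (use fE in simp)
  have "h \<in> hardy.span (proj S' ` E)"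
  proof (rule ccontr)
    assume nin: "h \<notin> hardy.span (proj S' ` E)"
    then have "h \<notin> proj S' ` E" using hardy.span_base by blast
    moreover have "hardy.independent (insert h (proj S' ` E))"
      using nin ind by (rule hardy.independent_insertI)
    moreover have "insert h (proj S' ` E) \<subseteq> hardy.span F"
      using FS \<open>h \<in> S'\<close> proj_in[OF S'] by auto
    ultimately have "Suc (card (proj S' ` E)) \<le> card F"
      using hardy.independent_span_bound[OF fF, of "insert h (proj S' ` E)"] fE by simp
    then show False using cards by (simp add: card_image[OF injE])
  qed
  then obtain u where "h = (\<Sum>x\<in>proj S' ` E. hscale (u x) x)"
    using hardy.span_finite[of "proj S' ` E"] fE by auto
  then have "h = proj S' (\<Sum>e\<in>E. hscale (u (proj S' e)) e)"
    by (simp add: lin sum.reindex[OF injE])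
  moreover have "(\<Sum>e\<in>E. hscale (u (proj S' e)) e) \<in> S"
    using E orthonormal_sum_in_span[of "\<lambda>e. u (proj S' e)" E] by (simp add: orthonormal_basis_def)
  ultimately show ?thesis by blast
qed

section \<open>The two estimates\<close>

text \<open>The exponential maps \<open>Za\<close> onto \<open>Zb\<close> and makes an angle of at
  most \<open>\<theta>\<close> with each vector. It therefore supplies partners in both directions,
  and \<open>blaschke_bound\<close> with \<open>C = cos \<theta>\<close> yields
  \<open>m \<le> sin \<theta>\<close>, for values of either Blaschke product.\<close>

lemma geodesic_exponent_bound:
  assumes A: "finite A" "A \<subseteq> ball 0 1" and B: "finite B" "B \<subseteq> ball 0 1" and "A \<inter> B = {}"
    and X: "geodesic_exponent (kernel_space A B) (vanishing_space A B A) (vanishing_space A B B) X"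
    and m: "m \<in> (\<lambda>b. cmod (blaschke A b)) ` B \<union> (\<lambda>a. cmod (blaschke B a)) ` A"
  shows "arcsin m \<le> op_norm_on (kernel_space A B) X"
proof -
  let ?V = "kernel_space A B" and ?Za = "vanishing_space A B A" and ?Zb = "vanishing_space A B B"
  let ?U = "op_exp (\<lambda>f. hscale \<i> (X f))"
  define \<theta> where "\<theta> = op_norm_on ?V X"
  have V: "fin_dim_subspace ?V" using A B by (intro fin_dim_kernel_space)
  have X': "self_adjoint_on ?V X" "\<theta> \<le> pi / 2" and img: "?U ` ?Za = ?Zb"
    using X unfolding geodesic_exponent_def \<theta>_def by auto
  have ZV: "?Za \<subseteq> ?V" by (auto simp: vanishing_space_def)
  have \<theta>0: "0 \<le> \<theta>" unfolding \<theta>_def using op_norm_on_nonneg[OF X'(1) V] .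
  have C0: "0 \<le> cos \<theta>" using \<theta>0 X'(2) by (intro cos_ge_zero) auto
  have U: "norm (?U f) = norm f" "cos \<theta> * (norm f)\<^sup>2 \<le> cmod (hinner f (?U f))" if "f \<in> ?Za" for f
    using op_exp_angle[OF X'(1) V X'(2)[unfolded \<theta>_def] subsetD[OF ZV that]]
    unfolding \<theta>_def by simp_all
  have 1: "\<exists>g\<in>?Zb. (cos \<theta> \<noteq> 0 \<longrightarrow> g \<noteq> 0) \<and> cos \<theta> * norm h * norm g \<le> cmod (hinner h g)"
    if "h \<in> ?Za" "h \<noteq> 0" for h
    using U[OF that(1)] that img
    by (intro bexI[of _ "?U h"]) (auto simp: power2_eq_square mult.assoc)
  \<comment> \<open>For the exchanged roles the partner of \<open>h\<close> is a preimage of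
    \<open>h\<close> under the exponential.\<close>
  have 2: "\<exists>g\<in>?Za. (cos \<theta> \<noteq> 0 \<longrightarrow> g \<noteq> 0) \<and> cos \<theta> * norm h * norm g \<le> cmod (hinner h g)"
    if h: "h \<in> ?Zb" "h \<noteq> 0" for h
  proof -
    have "h \<in> ?U ` ?Za" using h(1) unfolding img .
    then obtain g where g: "h = ?U g" "g \<in> ?Za" by (rule imageE)
    have n: "norm h = norm g" "cos \<theta> * (norm g)\<^sup>2 \<le> cmod (hinner g h)"
      unfolding g(1) by (rule U[OF g(2)])+
    have "cmod (hinner h g) = cmod (hinner g h)"
      by (subst hinner_commute) (rule complex_mod_cnj)
    then have "cos \<theta> * norm h * norm g \<le> cmod (hinner h g)"
      using n by (simp add: power2_eq_square mult.assoc)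
    moreover have "g \<noteq> 0" using n(1) h(2) by auto
    ultimately show ?thesis using g(2) by blast
  qed
  have "(cos \<theta>)\<^sup>2 + m\<^sup>2 \<le> 1"
    using m
  proof
    assume "m \<in> (\<lambda>b. cmod (blaschke A b)) ` B"
    then obtain b where b: "b \<in> B" "m = cmod (blaschke A b)" by blast
    then have "b \<notin> A" using \<open>A \<inter> B = {}\<close> by blast
    from blaschke_bound[OF A B(2) b(1) this C0 1] show ?thesis by (simp add: b(2))
  next
    assume "m \<in> (\<lambda>a. cmod (blaschke B a)) ` A"
    then obtain a where a: "a \<in> A" "m = cmod (blaschke B a)" by blast
    then have "a \<notin> B" using \<open>A \<inter> B = {}\<close> by blast
    from blaschke_bound[OF B A(2) a(1) this C0, unfolded vanishing_space_commute[of B A], OF 2]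
    show ?thesis by (simp add: a(2))
  qed
  then have "m\<^sup>2 \<le> (sin \<theta>)\<^sup>2" by (simp add: sin_squared_eq)
  moreover have "0 \<le> sin \<theta>" using \<theta>0 X'(2) by (intro sin_ge_zero) auto
  ultimately have "m \<le> sin \<theta>" by (rule power2_le_imp_le)
  moreover have "0 \<le> m" using m by auto
  ultimately have "arcsin m \<le> arcsin (sin \<theta>)" by (intro arcsin_le_arcsin) auto
  also have "\<dots> = \<theta>" using \<theta>0 X'(2) by (intro arcsin_sin) auto
  finally show ?thesis unfolding \<theta>_def .
qed

text \<open>If \<open>c > 0\<close>, the projection from \<open>Zb\<close> to \<open>Za\<close> is
  injective and, the dimensions being equal, onto. A preimage \<open>f\<close> of \<open>h\<close>
  satisfies \<open>hinner h f = hinner h h\<close>, and the norm of \<open>h\<close> is at least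
  \<open>c\<close> times that of \<open>f\<close>.\<close>

lemma least_singular_value_bound:
  assumes A: "finite A" "A \<subseteq> ball 0 1" and B: "finite B" "B \<subseteq> ball 0 1" and "A \<inter> B = {}"
    and n: "card A = n" "card B = n" "n \<ge> 1" and "w \<in> B"
  shows "singular_value (vanishing_space A B B)
      (proj (vanishing_space A B A) \<circ> proj (vanishing_space A B B)) (n - 1)
    \<le> sqrt (1 - (cmod (blaschke A w))\<^sup>2)"
proof -
  let ?Za = "vanishing_space A B A" and ?Zb = "vanishing_space A B B"
  define c where "c = singular_value ?Zb (proj ?Za \<circ> proj ?Zb) (n - 1)"
  have fa: "fin_dim_subspace ?Za" and fb: "fin_dim_subspace ?Zb"
    using A B by (auto intro: fin_dim_vanishing_space)
  have db: "hardy.dim ?Zb = n" using dim_vanishing_space[OF A B] assms by simp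
  have da: "hardy.dim ?Za = n"
    using dim_vanishing_space[OF B A] assms by (simp add: vanishing_space_commute[of B A] Int_commute)
  have c: "0 \<le> c" "\<And>f. f \<in> ?Zb \<Longrightarrow> c * norm f \<le> norm (proj ?Za f)"
    unfolding c_def using least_singular_value_projections[OF fb fa db n(3)] by blast+
  have "c\<^sup>2 + (cmod (blaschke A w))\<^sup>2 \<le> 1"
  proof (rule blaschke_bound[OF A B(2) \<open>w \<in> B\<close> _ c(1)])
    show "w \<notin> A" using assms by blast
    fix h assume h: "h \<in> ?Za" "h \<noteq> 0"
    show "\<exists>g\<in>?Zb. (c \<noteq> 0 \<longrightarrow> g \<noteq> 0) \<and> c * norm h * norm g \<le> cmod (hinner h g)"
    proof (cases "c = 0")
      \<comment> \<open>With \<open>c = 0\<close> the zero vector is an admissible partner.\<close>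
      case True
      have "0 \<in> ?Zb" using fb by (simp add: fin_dim_subspace_def hardy.subspace_0)
      then show ?thesis using True by auto
    next
      case False
      then have "f = 0" if "f \<in> ?Zb" "proj ?Za f = 0" for f
        using c(2)[OF that(1)] that(2) c(1) by (simp add: mult_le_0_iff)
      then obtain f where f: "f \<in> ?Zb" "proj ?Za f = h"
        using proj_surj[OF fb fa _ _ h(1)] db da by auto
      have "f \<noteq> 0" using f h(2) proj_hscale[OF fa, of 0 0] by auto
      have "hinner h f = hinner h h"
        using hinner_proj_right[OF fa h(1), of f] f(2) by simp
      then have "cmod (hinner h f) = (norm h)\<^sup>2" by (simp add: hinner_norm norm_power)
      moreover have "c * norm f * norm h \<le> norm h * norm h"
        using c(2)[OF f(1)] f(2) by (intro mult_right_mono) auto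
      ultimately show ?thesis
        using f(1) \<open>f \<noteq> 0\<close> by (intro bexI[of _ f]) (auto simp: power2_eq_square mult_ac)
    qed
  qed
  then have "c\<^sup>2 \<le> 1 - (cmod (blaschke A w))\<^sup>2" by simp
  then show ?thesis unfolding c_def[symmetric] by (rule real_le_rsqrt)
qed

theorem corollary4p15:
  fixes n :: nat and a b :: "nat \<Rightarrow> complex"
  assumes "n \<ge> 1"
    and "inj_on a {1..n}" and "inj_on b {1..n}"
    and "a ` {1..n} \<inter> b ` {1..n} = {}"
    and "a ` {1..n} \<subseteq> ball 0 1" and "b ` {1..n} \<subseteq> ball 0 1"
  defines "A \<equiv> a ` {1..n}" and "B \<equiv> b ` {1..n}"
  defines "H0 \<equiv> kernel_space A B"
    and "Za \<equiv> vanishing_space A B A" and "Zb \<equiv> vanishing_space A B B"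
  assumes "cmod (blaschke A (b 1)) = Max ((\<lambda>j. cmod (blaschke A (b j))) ` {1..n})"
  shows "singular_value Zb (proj Za \<circ> proj Zb) (n - 1) \<le> sqrt (1 - (cmod (blaschke A (b 1)))\<^sup>2) \<and>
    (\<forall>X. geodesic_exponent H0 Za Zb X \<longrightarrow>
       op_norm_on H0 X \<ge> arcsin (Max ((\<lambda>j. cmod (blaschke A (b j))) ` {1..n} \<union>
                                        (\<lambda>k. cmod (blaschke B (a k))) ` {1..n})))"
proof -
  have A: "finite A" "A \<subseteq> ball 0 1" and B: "finite B" "B \<subseteq> ball 0 1" and disj: "A \<inter> B = {}"
    and cards: "card A = n" "card B = n" and b1: "b 1 \<in> B"
    using assms(1-6) by (auto simp: A_def B_def card_image)
  let ?M = "(\<lambda>j. cmod (blaschke A (b j))) ` {1..n} \<union> (\<lambda>k. cmod (blaschke B (a k))) ` {1..n}"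
  \<comment> \<open>The maximum over this finite set, nonempty by \<open>n \<ge> 1\<close>, is
    attained, so it is one of the values \<open>m\<close> covered by
    \<open>geodesic_exponent_bound\<close>.\<close>
  have "Max ?M \<in> ?M" using assms(1) by (intro Max_in) auto
  then have "Max ?M \<in> (\<lambda>b. cmod (blaschke A b)) ` B \<union> (\<lambda>a. cmod (blaschke B a)) ` A"
    unfolding A_def B_def image_image .
  then show ?thesis
    unfolding H0_def Za_def Zb_def
    using least_singular_value_bound[OF A B disj cards assms(1) b1]
      geodesic_exponent_bound[OF A B disj] by blast
qed

end
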